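(* Suppose that $d<|a|$. Then the following momentum formulas hold for $w\in\mathbb{C}\setminus\{b\}$. First, $$\sum_{\sigma\in\Sigma}\prod_{n=1}^{\infty}\frac{Q\bigl(P_{\sigma_n}^{-1}\circ\cdots\circ P_{\sigma_1}^{-1}(w)\bigr)}{a}=f'(0)=1,\qquad \forall w\in\mathbb{C}\setminus\{b\}.$$ For the high orders $m\ge 2$, $$\sum_{\sigma\in\Sigma}\prod_{n=1}^{\infty}\frac{Q\bigl(P_{\sigma_n}^{-1}\circ\cdots\circ P_{\sigma_1}^{-1}(w)\bigr)^2}{a^2}=f'(0)^2-bf''(0)=1-\frac{bP''(b)}{a^2-a},$$ $$\sum_{\sigma\in\Sigma}\prod_{n=1}^{\infty}\frac{Q\bigl(P_{\sigma_n}^{-1}\circ\cdots\circ P_{\sigma_1}^{-1}(w)\bigr)^m}{a^m}=\sum_{j=1}^{m}\frac{(-b)^{m-j}(j-1)!}{(m-1)!}B_{m,j}\bigl(f'(0),\dots,f^{(m-j+1)}(0)\bigr),$$ where the derivatives of $f$ at $0$ are determined by $f'(0)=1$ and the recurrent formulas $$f''(0)=(a^2-a)^{-1}P''(b),$$ $$f^{(m)}(0)=(a^m-a)^{-1}\sum_{j=2}^{m}P^{(j)}(b)B_{m,j}\bigl(f'(0),\dots,f^{(m-j+1)}(0)\bigr),\qquad m\ge 2.$$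
   Context: Let $P$ be a complex polynomial of degree $d\ge 2$ and let $b\in\mathbb{C}$, $b\ne 0$, be a repelling fixed point of $P$: $P(b)=b$ and $|a|>1$, where $a:=P'(b)$. Let $f$ be the entire solution of $f(az)=P(f(z))$ ($z\in\mathbb{C}$) with $f(0)=b$, $f'(0)=1$; it can be taken as $f(z)=\lim_{n\to\infty}P^{\circ n}(b+a^{-n}z)$, the convergence being uniform on compact sets. Branches of $P^{-1}$: fix functions $P_0^{-1},\dots,P_{d-1}^{-1}:\mathbb{C}\to\mathbb{C}$ such that for every $w\in\mathbb{C}$ the values $P_0^{-1}(w),\dots,P_{d-1}^{-1}(w)$ form a complete set of solutions $z$ of $P(z)=w$, counted with multiplicity. The principal branch $P_0^{-1}$ satisfies $P_0^{-1}(b)=b$ and is analytic in some open neighbourhood of $b$; otherwise the numbering of the branches is arbitrary. Standing assumption (Hypothesis 1): for every $w\in\mathbb{C}$, the $n$-fold iterate $(P_0^{-1})^{\circ n}(w)\to b$ as $n\to\infty$. $Q$ is the polynomial $Q(z):=\frac{P(z)-b}{z-b}$. With $\mathbb{N}=\{1,2,\dots\}$, $$\Sigma=\{\sigma:\mathbb{N}\to\{0,\dots,d-1\}:\ \lim_{n\to\infty}\sigma_n=0\},$$ i.e. sequences which are eventually $0$. $B_{m,j}$ are the Bell polynomials $$B_{m,j}(x_1,\dots,x_{m-j+1})=\sum\frac{m!}{k_1!\cdots k_{m-j+1}!}\left(\frac{x_1}{1!}\right)^{k_1}\cdots\left(\frac{x_{m-j+1}}{(m-j+1)!}\right)^{k_{m-j+1}},$$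 the sum being over all sequences of non-negative integers $k_1,\dots,k_{m-j+1}$ with $\sum_{i=1}^{m-j+1} k_i=j$ and $\sum_{i=1}^{m-j+1} i k_i=m$.
   Formalization: For orders m≥2 the printed right-hand sides fail for general w (P=z²−2, b=2, w=−2, principal root: the second moment is 1/3, not 2/3); what is proved is the formula with w−b in place of −b for all w≠b, and the printed formulas at w=0. *)

theory Defs
  imports "HOL-Analysis.Analysis" "HOL-Computational_Algebra.Computational_Algebra"
begin

(* Exact division when b is a fixed point of P, see quot_poly_mult. *)
definition quot_poly :: "complex poly \<Rightarrow> complex \<Rightarrow> complex poly" where
  "quot_poly P b = (P - [:b:]) div [:- b, 1:]"

lemma quot_poly_mult:
  assumes "poly P b = b"
  shows "P - [:b:] = quot_poly P b * [:- b, 1:]"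
proof -
  have "[:- b, 1:] dvd P - [:b:]"
    using assms by (simp add: poly_eq_0_iff_dvd[symmetric])
  then show ?thesis
    unfolding quot_poly_def by (rule dvd_div_mult_self[symmetric])
qed

(* Sequences are indexed from 1; extensionality fixes the irrelevant value at 0,
   so that every sequence is counted exactly once. *)
definition eventually_zero_words :: "nat \<Rightarrow> (nat \<Rightarrow> nat) set" where
  "eventually_zero_words d = {\<sigma> \<in> {1..} \<rightarrow>\<^sub>E {..<d}. \<sigma> \<longlonglongrightarrow> 0}"

fun backward_orbit ::
  "(nat \<Rightarrow> complex \<Rightarrow> complex) \<Rightarrow> (nat \<Rightarrow> nat) \<Rightarrow> complex \<Rightarrow> nat \<Rightarrow> complex" where
  "backward_orbit R \<sigma> w 0 = w"
| "backward_orbit R \<sigma> w (Suc n) = R (\<sigma> (Suc n)) (backward_orbit R \<sigma> w n)"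

definition bell_indices :: "nat \<Rightarrow> nat \<Rightarrow> (nat \<Rightarrow> nat) set" where
  "bell_indices m j =
     {k \<in> {1..m - j + 1} \<rightarrow>\<^sub>E UNIV.
        (\<Sum>i=1..m - j + 1. k i) = j \<and> (\<Sum>i=1..m - j + 1. i * k i) = m}"

lemma finite_bell_indices: "finite (bell_indices m j)"
proof (rule finite_subset)
  show "bell_indices m j \<subseteq> {1..m - j + 1} \<rightarrow>\<^sub>E {..j}"
  proof
    fix k assume k: "k \<in> bell_indices m j"
    have "k i \<le> j" if "i \<in> {1..m - j + 1}" for i
      using k member_le_sum[of i "{1..m - j + 1}" k] that
      by (auto simp: bell_indices_def)
    then show "k \<in> {1..m - j + 1} \<rightarrow>\<^sub>E {..j}"
      using k by (auto simp: bell_indices_def PiE_iff)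
  qed
qed (simp add: finite_PiE)

(* Only meant for j \<le> m, since m - j is truncated. *)
definition bell_poly :: "nat \<Rightarrow> nat \<Rightarrow> (nat \<Rightarrow> complex) \<Rightarrow> complex" where
  "bell_poly m j x =
     (\<Sum>k\<in>bell_indices m j.
        fact m / (\<Prod>i=1..m - j + 1. fact (k i)) *
        (\<Prod>i=1..m - j + 1. (x i / fact i) ^ k i))"

end

theory Submission
  imports Defs "HOL-Complex_Analysis.Complex_Analysis"
begin

text \<open>
  Write \<open>w\<^sub>n\<close> for the backward orbit of \<open>w\<close> along a word \<open>\<sigma>\<close>. Since \<open>w\<^sub>n - b = Q(w\<^sub>n\<^sub>+\<^sub>1) (w\<^sub>n\<^sub>+\<^sub>1 - b)\<close>, the partial
  products telescope to \<open>(w - b) / (a^n (w\<^sub>n - b))\<close>, and \<open>a^n (w\<^sub>n - b)\<close> tends to a point \<open>\<zeta>\<close> with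
  \<open>f \<zeta> = w\<close>; so the \<open>m\<close>-th sum is \<open>(w - b)^m\<close> times the sum of all \<open>\<zeta>^(-m)\<close>. No Hadamard factorization
  of \<open>f - w\<close> is needed: the \<open>n\<close>-th iterate of \<open>P\<close> minus \<open>w\<close> splits into the \<open>d^n\<close> factors given by the
  words of length \<open>n\<close>, and composing with \<open>f(z / a^n)\<close> gives a factorization of \<open>f - w\<close>. Comparing
  coefficients of its logarithm shows that the power sums of \<open>1 / (a^n (w\<^sub>n - b))\<close> over these words
  converge to a coefficient of \<open>- log (1 - (f - b) / (w - b))\<close>, which is the Bell polynomial expression.
  Finally these finite power sums differ from partial sums of \<open>\<zeta>^(-m)\<close> by \<open>O((d / |a|)^n)\<close>.
\<close>

unbundle no vec_syntax

subsection \<open>Powers and logarithms of formal power series\<close>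

lemma divided_power_add:
  fixes x y :: "'a :: field_char_0 fps"
  shows "fps_const (1 / fact j) * (x + y) ^ j =
    (\<Sum>l\<le>j. (fps_const (1 / fact l) * x ^ l) * (fps_const (1 / fact (j - l)) * y ^ (j - l)))"
proof -
  have "fps_const (1 / fact j) * (x + y) ^ j =
     (\<Sum>l\<le>j. fps_const (1 / fact j) * (fps_const (of_nat (j choose l)) * x ^ l * y ^ (j - l)))"
    by (simp add: binomial_ring sum_distrib_left fps_of_nat)
  also have "\<dots> = (\<Sum>l\<le>j. (fps_const (1 / fact l) * x ^ l) * (fps_const (1 / fact (j - l)) * y ^ (j - l)))"
  proof (rule sum.cong)
    fix l assume l: "l \<in> {..j}"
    then have eq: "1 / fact j * of_nat (j choose l) = (1 / fact l * (1 / fact (j - l)) :: 'a)"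
      by (simp add: binomial_fact)
    have "fps_const (1 / fact j) * fps_const (of_nat (j choose l)) = 
          fps_const (1 / fact l) * fps_const (1 / fact (j - l) :: 'a)"
      unfolding fps_const_mult eq ..
    then show "fps_const (1 / fact j) * (fps_const (of_nat (j choose l)) * x ^ l * y ^ (j - l)) =
      (fps_const (1 / fact l) * x ^ l) * (fps_const (1 / fact (j - l)) * y ^ (j - l))"
      by (simp only: mult.assoc[symmetric]) (simp only: ac_simps)
  qed simp
  finally show ?thesis .
qed

lemma finite_compositions:
  assumes "finite A"
  shows "finite {k. k \<in> A \<rightarrow>\<^sub>E (UNIV :: nat set) \<and> (\<Sum>i\<in>A. k i) = j}"
proof (rule finite_subset)
  show "{k. k \<in> A \<rightarrow>\<^sub>E (UNIV :: nat set) \<and> (\<Sum>i\<in>A. k i) = j} \<subseteq> A \<rightarrow>\<^sub>E {..j}"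
  proof
    fix k assume k: "k \<in> {k. k \<in> A \<rightarrow>\<^sub>E (UNIV :: nat set) \<and> (\<Sum>i\<in>A. k i) = j}"
    have "k i \<le> j" if "i \<in> A" for i
      using member_le_sum[of i A k] k that assms by auto
    then show "k \<in> A \<rightarrow>\<^sub>E {..j}" using k by (simp add: PiE_iff)
  qed
qed (use assms in \<open>simp add: finite_PiE\<close>)

text \<open>The multinomial theorem for divided powers \<open>x ^ j / j!\<close>, where no binomial
  coefficients appear; this is the shape of the summands of \<open>bell_poly\<close>. In the
  induction a multi-index on \<open>insert x A\<close> is split into its value at \<open>x\<close>
  and its restriction to \<open>A\<close>.\<close>

lemma divided_power_sum:
  fixes g :: "'i \<Rightarrow> 'a :: field_char_0 fps"
  assumes "finite A"
  shows "fps_const (1 / fact j) * (\<Sum>i\<in>A. g i) ^ j =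
    (\<Sum>k | k \<in> A \<rightarrow>\<^sub>E UNIV \<and> (\<Sum>i\<in>A. k i) = j. \<Prod>i\<in>A. fps_const (1 / fact (k i)) * g i ^ k i)"
  using assms
proof (induction A arbitrary: j rule: finite_induct)
  case empty
  \<comment> \<open>The only extensional function on the empty set has sum 0, so it is counted
    exactly when \<open>j = 0\<close>.\<close>
  have "{k. k = (\<lambda>x. undefined) \<and> j = 0} = (if j = 0 then {\<lambda>x. undefined :: nat} else {})"
    by auto
  then show ?case by (auto simp: power_0_left)
next
  case (insert x A)
  let ?I = "\<lambda>A j. {k. k \<in> A \<rightarrow>\<^sub>E (UNIV :: nat set) \<and> (\<Sum>i\<in>A. k i) = j}"
  let ?p = "\<lambda>k i. fps_const (1 / fact (k i)) * g i ^ k i"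
  have fin: "finite (?I A j)" for j
    using insert.hyps(1) by (rule finite_compositions)
  have "fps_const (1 / fact j) * (\<Sum>i\<in>insert x A. g i) ^ j =
    (\<Sum>l\<le>j. (fps_const (1 / fact l) * g x ^ l) * (fps_const (1 / fact (j - l)) * (\<Sum>i\<in>A. g i) ^ (j - l)))"
    using insert.hyps by (simp add: divided_power_add)
  also have "\<dots> = (\<Sum>l\<le>j. \<Sum>k\<in>?I A (j - l). (fps_const (1 / fact l) * g x ^ l) * (\<Prod>i\<in>A. ?p k i))"
    by (simp add: insert.IH sum_distrib_left)
  also have "\<dots> = (\<Sum>(l, k)\<in>Sigma {..j} (\<lambda>l. ?I A (j - l)). (fps_const (1 / fact l) * g x ^ l) * (\<Prod>i\<in>A. ?p k i))"
    by (subst sum.Sigma) (use fin in auto)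
  also have "\<dots> = (\<Sum>k\<in>?I (insert x A) j. \<Prod>i\<in>insert x A. ?p k i)"
  proof (rule sum.reindex_bij_witness[of _ "\<lambda>k. (k x, restrict k A)" "\<lambda>(l, k). k(x := l)"], goal_cases)
    case (1 p)
    then show ?case using insert.hyps
      by (auto simp: fun_eq_iff PiE_iff extensional_def restrict_def)
  next
    case (2 p)
    obtain l k where p: "p = (l, k)" by (cases p)
    have "(\<Sum>i\<in>A. if i = x then l else k i) = (\<Sum>i\<in>A. k i)"
      using insert.hyps by (intro sum.cong) auto
    then show ?case using 2 insert.hyps p by (auto simp: PiE_iff extensional_def)
  next
    case (3 k)
    then show ?case by (auto simp: fun_eq_iff PiE_iff extensional_def)
  next
    case (4 k)
    then show ?case using insert.hyps by (auto simp: PiE_iff extensional_def)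
  next
    case (5 p)
    obtain l k where p: "p = (l, k)" by (cases p)
    have "(\<Prod>i\<in>A. ?p (k(x := l)) i) = (\<Prod>i\<in>A. ?p k i)"
      using insert.hyps by (intro prod.cong) auto
    then show ?case using insert.hyps p by simp
  qed
  finally show ?case .
qed

lemma fps_power_nth_cong:
  fixes F G :: "'a :: comm_ring_1 fps"
  assumes "\<And>i. i \<le> n \<Longrightarrow> F $ i = G $ i" "i \<le> n"
  shows "(F ^ j) $ i = (G ^ j) $ i"
  using assms(2)
  by (induction j arbitrary: i) (auto simp: fps_mult_nth assms(1) intro!: sum.cong)

text \<open>Writing \<open>H = fps_X * fps_shift 1 H\<close> turns coefficient \<open>m\<close> of
  \<open>H ^ j\<close> into coefficient \<open>m - j\<close> of the power of the shift, which sees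
  \<open>H\<close> only up to index \<open>m - j + 1\<close>. This is why
  \<open>bell_poly m j\<close> has \<open>m - j + 1\<close> arguments.\<close>

lemma fps_power_nth_cong_shift:
  fixes F G :: "'a :: comm_ring_1 fps"
  assumes "F $ 0 = 0" "G $ 0 = 0" "\<And>i. i \<le> m - j + 1 \<Longrightarrow> F $ i = G $ i" "j \<le> m"
  shows "(F ^ j) $ m = (G ^ j) $ m"
proof -
  have *: "(H ^ j) $ m = (fps_shift 1 H ^ j) $ (m - j)" if "H $ 0 = 0" for H :: "'a fps"
  proof -
    have "H = fps_X * fps_shift 1 H" using that
      by (auto simp: fps_eq_iff)
    then have "H ^ j = fps_X ^ j * fps_shift 1 H ^ j"
      by (metis power_mult_distrib)
    then show ?thesis using \<open>j \<le> m\<close> by (simp add: fps_X_power_mult_nth)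
  qed
  show ?thesis
    unfolding *[OF assms(1)] *[OF assms(2)]
    by (rule fps_power_nth_cong[where n = "m - j"]) (use assms(3) in auto)
qed

lemma monomial_nth: "(fps_const c * fps_X ^ n :: 'a :: comm_ring_1 fps) $ m = (if n = m then c else 0)"
  by simp

text \<open>Powers of a series generate the Bell polynomials: after truncation to \<open>G\<close>,
  \<open>divided_power_sum\<close> expands the power into monomials, and picking out coefficient
  \<open>m\<close> imposes the second condition in \<open>bell_indices\<close>.\<close>

lemma fps_power_nth_bell_poly:
  fixes F :: "complex fps"
  assumes "F $ 0 = 0" "j \<le> m"
  shows "(F ^ j) $ m = fact j / fact m * bell_poly m j (\<lambda>i. fact i * F $ i)"
proof -
  define N where "N = m - j + 1"
  define G where "G = (\<Sum>i=1..N. fps_const (F $ i) * fps_X ^ i)"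
  have G: "G $ i = (if i \<in> {1..N} then F $ i else 0)" for i
  proof -
    have "G $ i = (\<Sum>l=1..N. if i = l then F $ l else 0)"
      unfolding G_def fps_sum_nth by (intro sum.cong) (auto)
    then show ?thesis by simp
  qed
  have "(F ^ j) $ m = (G ^ j) $ m"
    by (rule fps_power_nth_cong_shift) (use assms G in \<open>auto simp: N_def Suc_le_eq\<close>)
  also have "G ^ j = fps_const (fact j) * (fps_const (1 / fact j) * G ^ j)"
    by (simp add: mult.assoc[symmetric])
  also have "fps_const (1 / fact j) * G ^ j = (\<Sum>k | k \<in> {1..N} \<rightarrow>\<^sub>E UNIV \<and> (\<Sum>i=1..N. k i) = j.
     \<Prod>i=1..N. fps_const (1 / fact (k i)) * (fps_const (F $ i) * fps_X ^ i) ^ k i)"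
    unfolding G_def by (rule divided_power_sum) simp
  also have "\<dots> = (\<Sum>k | k \<in> {1..N} \<rightarrow>\<^sub>E UNIV \<and> (\<Sum>i=1..N. k i) = j.
     fps_const (\<Prod>i=1..N. 1 / fact (k i) * (F $ i) ^ k i) * fps_X ^ (\<Sum>i=1..N. i * k i))"
  proof (rule sum.cong)
    fix k
    have "(\<Prod>i=1..N. fps_const (1 / fact (k i)) * (fps_const (F $ i) * fps_X ^ i) ^ k i) =
       (\<Prod>i=1..N. fps_const (1 / fact (k i) * (F $ i) ^ k i) * fps_X ^ (i * k i))"
      by (intro prod.cong refl) (simp only: power_mult_distrib power_mult fps_const_power fps_const_mult[symmetric] mult.assoc)
    also have "\<dots> = (\<Prod>i=1..N. fps_const (1 / fact (k i) * (F $ i) ^ k i)) * fps_X ^ (\<Sum>i=1..N. i * k i)"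
      by (simp only: prod.distrib power_sum)
    also have "(\<Prod>i\<in>A. fps_const (h i)) = fps_const (\<Prod>i\<in>A. h i)" for h :: "nat \<Rightarrow> complex" and A
      by (induction A rule: infinite_finite_induct) auto
    finally show "(\<Prod>i=1..N. fps_const (1 / fact (k i)) * (fps_const (F $ i) * fps_X ^ i) ^ k i) =
      fps_const (\<Prod>i=1..N. 1 / fact (k i) * (F $ i) ^ k i) * fps_X ^ (\<Sum>i=1..N. i * k i)" .
  qed simp
  finally have "(F ^ j) $ m = fact j * (\<Sum>k | k \<in> {1..N} \<rightarrow>\<^sub>E UNIV \<and> (\<Sum>i=1..N. k i) = j.
      if (\<Sum>i=1..N. i * k i) = m then (\<Prod>i=1..N. 1 / fact (k i) * (F $ i) ^ k i) else 0)"
    by (simp only: fps_mult_left_const_nth[where c = "fact j"] fps_sum_nth monomial_nth)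
  also have "\<dots> = fact j * (\<Sum>k\<in>bell_indices m j. \<Prod>i=1..N. 1 / fact (k i) * (F $ i) ^ k i)"
  proof -
    have "finite {k. k \<in> {1..N} \<rightarrow>\<^sub>E (UNIV :: nat set) \<and> (\<Sum>i=1..N. k i) = j}"
      by (rule finite_compositions) simp
    then show ?thesis unfolding bell_indices_def N_def[symmetric]
      by (subst sum.inter_filter[symmetric]) (auto intro!: sum.cong)
  qed
  also have "\<dots> = fact j / fact m * bell_poly m j (\<lambda>i. fact i * F $ i)"
    unfolding bell_poly_def N_def[symmetric]
    by (simp add: sum_distrib_left prod.distrib prod_dividef mult_ac)
  finally show ?thesis .
qed

text \<open>The series of \<open>- log (1 - s X)\<close>. Its constant coefficient is a division by
  zero, hence 0.\<close>

definition log_series :: "'a :: field_char_0 \<Rightarrow> 'a fps" where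
  "log_series s = Abs_fps (\<lambda>j. s ^ j / of_nat j)"

lemma log_series_nth_0 [simp]: "log_series s $ 0 = 0"
  by (simp add: log_series_def)

lemma fps_deriv_log_series: "fps_deriv (log_series s) * (1 - fps_const s * fps_X) = fps_const s"
proof -
  have *: "fps_deriv (log_series s) $ n = s * s ^ n" for n
    by (simp add: log_series_def del: of_nat_Suc)
  have "(fps_deriv (log_series s) * (1 - fps_const s * fps_X)) $ n = fps_const s $ n" for n
  proof -
    have "fps_deriv (log_series s) * (1 - fps_const s * fps_X) =
      fps_deriv (log_series s) - fps_const s * (fps_X * fps_deriv (log_series s))"
      by (simp add: algebra_simps del: fps_deriv_nth)
    then show ?thesis by (cases n) (simp_all add: * del: fps_deriv_nth)
  qed
  then show ?thesis by (simp add: fps_eq_iff)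
qed

text \<open>Takes minus the logarithm of the product in \<open>prod\<close>: both sides have the
  same logarithmic derivative and constant coefficient 0.\<close>

lemma log_series_compose_prod:
  fixes \<phi> F :: "'a :: field_char_0 fps"
  assumes "finite E" "\<phi> $ 0 = 0" "F $ 0 = 0"
    and prod: "1 - fps_const s0 * F = (\<Prod>e\<in>E. 1 - fps_const (s e) * \<phi>)"
  shows "log_series s0 oo F = (\<Sum>e\<in>E. log_series (s e)) oo \<phi>"
proof -
  \<comment> \<open>Logarithmic derivative with the denominator cleared;
    \<open>log_series c oo H\<close> stands for \<open>- log (1 - c H)\<close>.\<close>
  have D: "fps_deriv (log_series c oo H) * (1 - fps_const c * H) = - fps_deriv (1 - fps_const c * H)"
    if "H $ 0 = 0" for c and H :: "'a fps"
  proof -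
    have "fps_deriv (log_series c) * (1 - fps_const c * fps_X) oo H = fps_const c oo H"
      by (simp only: fps_deriv_log_series)
    then have "(fps_deriv (log_series c) oo H) * (1 - fps_const c * H) = fps_const c"
      using that by (simp add: fps_compose_mult_distrib fps_compose_sub_distrib)
    then have "(fps_deriv (log_series c) oo H) * (1 - fps_const c * H) * fps_deriv H = fps_const c * fps_deriv H"
      by simp
    then show ?thesis using that
      by (simp add: fps_compose_deriv mult_ac)
  qed
  have *: "fps_deriv (\<Sum>e\<in>E'. log_series (s e) oo \<phi>) * (\<Prod>e\<in>E'. 1 - fps_const (s e) * \<phi>) =
     - fps_deriv (\<Prod>e\<in>E'. 1 - fps_const (s e) * \<phi>)" if "finite E'" for E'
    using that
  proof induction
    case (insert x E')
    let ?f = "1 - fps_const (s x) * \<phi>" and ?g = "\<Prod>e\<in>E'. 1 - fps_const (s e) * \<phi>"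
    have "fps_deriv (\<Sum>e\<in>insert x E'. log_series (s e) oo \<phi>) * (\<Prod>e\<in>insert x E'. 1 - fps_const (s e) * \<phi>)
      = (fps_deriv (log_series (s x) oo \<phi>) * ?f) * ?g + ?f * (fps_deriv (\<Sum>e\<in>E'. log_series (s e) oo \<phi>) * ?g)"
      using insert.hyps by (simp add: algebra_simps)
    also have "\<dots> = - fps_deriv (?f * ?g)"
      unfolding D[OF assms(2)] insert.IH by (simp add: algebra_simps)
    finally show ?case using insert.hyps by simp
  qed simp
  \<comment> \<open>The constant coefficient is 1, so this factor can be cancelled.\<close>
  have nz: "1 - fps_const s0 * F \<noteq> 0"
  proof
    assume "1 - fps_const s0 * F = 0"
    then have "(1 - fps_const s0 * F) $ 0 = 0" by simp
    then show False using \<open>F $ 0 = 0\<close> by simp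
  qed
  have "fps_deriv (log_series s0 oo F) * (1 - fps_const s0 * F) =
      fps_deriv (\<Sum>e\<in>E. log_series (s e) oo \<phi>) * (1 - fps_const s0 * F)"
    using D[OF assms(3), of s0] *[OF assms(1)] by (simp add: prod)
  then have "fps_deriv (log_series s0 oo F) = fps_deriv (\<Sum>e\<in>E. log_series (s e) oo \<phi>)"
    using nz by simp
  then have "log_series s0 oo F = (\<Sum>e\<in>E. log_series (s e) oo \<phi>)"
    by (subst (asm) fps_deriv_eq_iff) (simp add: fps_sum_nth)
  then show ?thesis by (simp add: fps_compose_sum_distrib)
qed

text \<open>Taylor expansion of \<open>P\<close> at \<open>b\<close>: the \<open>j\<close>-th
  derivative of the shifted polynomial is evaluated at 0 in two ways.\<close>

lemma coeff_pcompose_shift: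
  fixes P :: "'a :: field_char_0 poly"
  shows "coeff (pcompose P [:b, 1:]) j = poly ((pderiv ^^ j) P) b / fact j"
proof -
  have *: "(pderiv ^^ j) (pcompose P [:b, 1:]) = pcompose ((pderiv ^^ j) P) [:b, 1:]"
    by (induction j) (simp_all add: pderiv_pcompose pderiv_pCons)
  have "coeff ((pderiv ^^ j) (pcompose P [:b, 1:])) 0 = fact j * coeff (pcompose P [:b, 1:]) j"
    by (simp add: coeff_higher_pderiv pochhammer_fact)
  moreover have "coeff ((pderiv ^^ j) (pcompose P [:b, 1:])) 0 = poly ((pderiv ^^ j) P) b"
    unfolding * by (simp add: coeff_pcompose_0)
  ultimately show ?thesis by (simp add: field_simps)
qed

subsection \<open>Local behaviour at the fixed point\<close>

locale poincare_function =
  fixes P :: "complex poly" and d :: nat and a b :: complex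
    and f :: "complex \<Rightarrow> complex" and R :: "nat \<Rightarrow> complex \<Rightarrow> complex"
  assumes degree_P: "degree P = d" and d_ge_2: "d \<ge> 2"
    and fixed_point: "poly P b = b" and multiplier: "a = poly (pderiv P) b"
    and repelling: "norm a > 1"
    and holo: "f holomorphic_on UNIV" and functional_eq: "\<And>z. f (a * z) = poly P (f z)"
    and f_0: "f 0 = b" and deriv_f_0: "deriv f 0 = 1"
    and branches: "\<And>w. image_mset (\<lambda>i. R i w) (mset_set {..<d}) = proots (P - [:w:])"
    and principal_fixed: "R 0 b = b" and principal_cont: "isCont (R 0) b"
    and principal_attracts: "\<And>w. (\<lambda>n. (R 0 ^^ n) w) \<longlonglongrightarrow> b"
    and growth: "real d < norm a"
begin

lemma a_nonzero: "a \<noteq> 0" using repelling by auto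

lemma poly_diff_branches:
  "poly P u - w = lead_coeff P * (\<Prod>i<d. u - R i w)"
proof -
  have deg: "degree (P - [:w:]) = d"
    using degree_P d_ge_2 degree_add_eq_left[of "- [:w:]" P] by (simp del: minus_pCons)
  have lead: "lead_coeff (P - [:w:]) = lead_coeff P"
    unfolding deg degree_P using d_ge_2 by (simp add: coeff_pCons split: nat.splits)
  have "poly P u - w = poly (P - [:w:]) u" by simp
  also have "P - [:w:] = smult (lead_coeff P) (\<Prod>x\<in>#proots (P - [:w:]). [:-x, 1:])"
  proof -
    have "P - [:w:] = smult (lead_coeff (P - [:w:])) (\<Prod>x\<in>#proots (P - [:w:]). [:-x, 1:])"
      by (rule complex_poly_decompose_multiset[symmetric])
    then show ?thesis by (simp only: lead)
  qed
  also have "poly \<dots> u = lead_coeff P * (\<Prod>i<d. u - R i w)"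
    unfolding branches[symmetric]
    by (simp add: poly_prod_mset image_mset.compositionality o_def prod_unfold_prod_mset)
  finally show ?thesis .
qed

lemma poly_branch: 
  assumes "i < d"
  shows "poly P (R i w) = w"
proof -
  have "(\<Prod>j<d. R i w - R j w) = 0"
    by (rule prod_zero) (use assms in auto)
  then have "poly P (R i w) - w = 0" unfolding poly_diff_branches by simp
  then show ?thesis by simp
qed

text \<open>Otherwise \<open>u\<close> would be a double root of \<open>P - w\<close>, with cofactor
  \<open>g\<close>, and the derivative of \<open>P\<close> would vanish there.\<close>

lemma branch_unique:
  assumes "i < d" "j < d" "R i w = u" "R j w = u" "poly (pderiv P) u \<noteq> 0"
  shows "i = j"
proof (rule ccontr)
  assume "i \<noteq> j"
  define g where "g = (\<lambda>v. lead_coeff P * (\<Prod>k\<in>{..<d} - {i, j}. v - R k w))"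
  have eq: "poly P v = w + (v - u) ^ 2 * g v" for v
  proof -
    have "(\<Prod>k<d. v - R k w) = (v - R i w) * ((v - R j w) * (\<Prod>k\<in>{..<d} - {i} - {j}. v - R k w))"
      using assms \<open>i \<noteq> j\<close> by (subst prod.remove[of _ i], simp, simp, subst prod.remove[of _ j]) auto
    also have "{..<d} - {i} - {j} = {..<d} - {i, j}" by auto
    finally have "poly P v - w = (v - u) ^ 2 * g v"
      unfolding poly_diff_branches by (simp add: assms g_def power2_eq_square mult_ac)
    then show ?thesis by (simp add: algebra_simps)
  qed
  obtain g' where g': "(g has_field_derivative g') (at u)"
  proof -
    have "g field_differentiable at u"
      unfolding g_def
      by (intro analytic_on_imp_differentiable_at[of _ UNIV] analytic_intros) auto
    then show thesis using that by (auto simp: field_differentiable_def)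
  qed
  have "((\<lambda>v. w + (v - u) ^ 2 * g v) has_field_derivative 0) (at u)"
    by (auto intro!: derivative_eq_intros g')
  then have "(poly P has_field_derivative 0) (at u)"
    by (simp add: eq[symmetric])
  then have "poly (pderiv P) u = 0"
    using DERIV_unique poly_DERIV by blast
  then show False using assms by simp
qed

lemma f_has_deriv: "(f has_field_derivative deriv f z) (at z)"
  using holo by (simp add: holomorphic_derivI)

lemma isCont_f: "isCont f z"
  using f_has_deriv DERIV_isCont by blast

lemma P_iterate_f: "(poly P ^^ n) (f z) = f (a ^ n * z)"
  by (induction n) (simp_all add: functional_eq mult.assoc)

text \<open>Taylor's theorem at 0, where \<open>f\<close> has value \<open>b\<close> and derivative
  1; \<open>K\<close> bounds the second derivative on the closed unit disc.\<close>

lemma f_second_order: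
  obtains K where "K > 0" "\<And>z. norm z \<le> 1 \<Longrightarrow> norm (f z - b - z) \<le> K * norm z ^ 2"
proof -
  have "continuous_on (cball 0 1) ((deriv ^^ 2) f)"
    by (intro holomorphic_on_imp_continuous_on holomorphic_on_subset[OF holomorphic_higher_deriv[OF holo]]) auto
  then have "bounded ((deriv ^^ 2) f ` cball 0 1)"
    by (intro compact_imp_bounded compact_continuous_image) auto
  then obtain K where K: "K > 0" "\<And>x. x \<in> cball 0 1 \<Longrightarrow> norm ((deriv ^^ 2) f x) \<le> K"
    by (auto simp: bounded_pos)
  have "norm (f z - b - z) \<le> K * norm z ^ 2" if "norm z \<le> 1" for z
  proof -
    have "norm ((deriv ^^ 0) f z - (\<Sum>i\<le>1. (deriv ^^ i) f 0 * (z - 0) ^ i / fact i)) \<le> K * norm (z - 0) ^ Suc 1 / fact 1"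
    proof (rule complex_Taylor[where S = "cball 0 1" and f = "\<lambda>i. (deriv ^^ i) f"])
      fix i x
      show "((deriv ^^ i) f has_field_derivative (deriv ^^ Suc i) f x) (at x within cball 0 1)"
        using holomorphic_derivI[OF holomorphic_higher_deriv[OF holo, of i]]
        by (simp add: has_field_derivative_at_within)
    qed (use K that in \<open>auto simp: numeral_2_eq_2\<close>)
    then show ?thesis by (simp add: f_0 deriv_f_0 numeral_2_eq_2 algebra_simps)
  qed
  then show thesis using K that by blast
qed

text \<open>The principal branch is the local inverse of \<open>P\<close> at \<open>b\<close>, and
  \<open>f\<close> conjugates \<open>P\<close> to multiplication by \<open>a\<close>; so in the disc
  of radius \<open>r\<close> this branch becomes division by \<open>a\<close>, and no other branch
  does. The disc of radius \<open>c\<close> around \<open>b\<close> is covered by \<open>f\<close>,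
  and \<open>K\<close> measures how well \<open>f z - b\<close> is approximated by
  \<open>z\<close>.\<close>

lemma local_linearization:
  obtains r c K where "r > 0" "c > 0" "K > 0"
    "\<forall>z. norm z < r \<longrightarrow> R 0 (f z) = f (z / a)"
    "\<forall>z i. norm z < r \<longrightarrow> i < d \<longrightarrow> R i (f z) = f (z / a) \<longrightarrow> i = 0"
    "\<forall>u. norm (u - b) < c \<longrightarrow> (\<exists>z. norm z < r \<and> f z = u)"
    "\<forall>z. norm z < r \<longrightarrow> z \<noteq> 0 \<longrightarrow> norm (z / (f z - b) - 1) \<le> K * norm z"
proof -
  have dP: "deriv (poly P) = poly (pderiv P)"
    by (rule ext) (rule DERIV_imp_deriv[OF poly_DERIV])
  have holP: "poly P holomorphic_on S" for S
    by (intro holomorphic_intros)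
  \<comment> \<open>The derivative at \<open>b\<close> is \<open>a\<close>, so \<open>P\<close> is
    injective on a ball around \<open>b\<close>; injectivity in turn keeps the derivative nonzero on
    the whole ball.\<close>
  have "deriv (poly P) b \<noteq> 0"
    using dP a_nonzero multiplier by simp
  then obtain e where e: "e > 0" "inj_on (poly P) (ball b e)"
    using has_complex_derivative_locally_injective[OF holP UNIV_I open_UNIV] by blast
  have nz: "poly (pderiv P) u \<noteq> 0" if "u \<in> ball b e" for u
  proof -
    have "deriv (poly P) u \<noteq> 0"
      using holomorphic_injective_imp_regular[OF holP open_ball e(2) that] .
    then show ?thesis by (simp add: dP)
  qed
  obtain \<delta> where \<delta>: "\<delta> > 0" "\<And>u. dist u b < \<delta> \<Longrightarrow> dist (R 0 u) b < e"
    using principal_cont e(1) principal_fixed by (metis continuous_at_eps_delta)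
  obtain r0 where r0: "r0 > 0" "\<And>z. norm z < r0 \<Longrightarrow> dist (f z) b < min e \<delta>"
    using isCont_f[of 0] e(1) \<delta>(1) f_0 unfolding continuous_at_eps_delta
    by (metis diff_zero dist_norm min_less_iff_conj)
  obtain K where K: "K > 0" "\<And>z. norm z \<le> 1 \<Longrightarrow> norm (f z - b - z) \<le> K * norm z ^ 2"
    using f_second_order by blast
  \<comment> \<open>\<open>r0\<close> keeps \<open>f z\<close> and its principal preimage in the
    ball of injectivity, 1 is the range of the Taylor estimate, and \<open>1 / (2 * K)\<close> makes
    the Taylor error at most half of \<open>norm z\<close>.\<close>
  define r where "r = min r0 (min 1 (1 / (2 * K)))"
  have r: "r > 0" "r \<le> r0" "r \<le> 1" "r \<le> 1 / (2 * K)"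
    using r0 K by (auto simp: r_def)
  have za: "norm (z / a) < r" if "norm z < r" for z
  proof -
    have "norm z / norm a \<le> norm z" using repelling by (simp add: divide_le_eq mult_le_cancel_left1)
    then show ?thesis using that by (simp add: norm_divide)
  qed
  have Pz: "poly P (f (z / a)) = f z" for z
    using functional_eq[of "z / a"] a_nonzero by simp
  \<comment> \<open>Both points lie in the ball of injectivity and are sent by \<open>P\<close> to
    \<open>f z\<close>.\<close>
  have 1: "R 0 (f z) = f (z / a)" if "norm z < r" for z
  proof -
    have "f (z / a) \<in> ball b e" using r0(2)[of "z / a"] za[OF that] r by (simp add: dist_commute)
    moreover have "R 0 (f z) \<in> ball b e"
      using \<delta>(2)[of "f z"] r0(2)[of z] that r by (simp add: dist_commute)
    moreover have "poly P (R 0 (f z)) = poly P (f (z / a))"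
      using poly_branch[of 0 "f z"] d_ge_2 Pz by simp
    ultimately show ?thesis using e(2) by (auto dest: inj_onD)
  qed
  have 2: "i = 0" if "norm z < r" "i < d" "R i (f z) = f (z / a)" for z i
  proof (rule branch_unique)
    show "poly (pderiv P) (f (z / a)) \<noteq> 0"
      using r0(2)[of "z / a"] za[OF that(1)] r by (intro nz) (simp add: dist_commute)
  qed (use that 1 d_ge_2 in auto)
  \<comment> \<open>Open mapping theorem; \<open>f\<close> is not constant because its derivative at
    0 is 1.\<close>
  obtain c where c: "c > 0" "\<And>u. norm (u - b) < c \<Longrightarrow> \<exists>z. norm z < r \<and> f z = u"
  proof -
    have "\<not> f constant_on UNIV"
    proof
      assume "f constant_on UNIV"
      then obtain k where "f = (\<lambda>_. k)" by (auto simp: constant_on_def)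
      then show False using deriv_f_0 by simp
    qed
    then have "open (f ` ball 0 r)"
      by (intro open_mapping_thm[OF holo]) auto
    moreover have "b \<in> f ` ball 0 r" using f_0 r by (intro image_eqI[of _ _ 0]) auto
    ultimately obtain c where "c > 0" "ball b c \<subseteq> f ` ball 0 r"
      by (auto simp: open_contains_ball)
    moreover have "\<exists>z. norm z < r \<and> f z = u" if "norm (u - b) < c" for u
    proof -
      have "u \<in> ball b c" using that by (simp add: dist_norm norm_minus_commute)
      then have "u \<in> f ` ball 0 r" using \<open>ball b c \<subseteq> f ` ball 0 r\<close> by blast
      then show ?thesis by auto
    qed
    ultimately show thesis using that by blast
  qed
  have 4: "norm (z / (f z - b) - 1) \<le> 2 * K * norm z" if "norm z < r" "z \<noteq> 0" for z
  proof -
    have le: "norm (f z - b - z) \<le> K * norm z ^ 2" using K(2)[of z] that r by simp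
    have "K * norm z \<le> 1 / 2"
      using mult_left_mono[of "norm z" "1 / (2 * K)" K] that r K by simp
    then have "K * norm z * norm z \<le> 1 / 2 * norm z"
      by (intro mult_right_mono) auto
    then have half: "norm (f z - b - z) \<le> norm z / 2"
      using le by (simp add: power2_eq_square)
    have ge: "norm (f z - b) \<ge> norm z / 2"
      using norm_triangle_ineq4[of "f z - b" "f z - b - z"] half by simp
    then have nz: "f z - b \<noteq> 0" using that by auto
    have "norm (z / (f z - b) - 1) = norm (f z - b - z) / norm (f z - b)"
      using nz by (simp add: divide_diff_eq_iff norm_divide norm_minus_commute algebra_simps)
    also have "\<dots> \<le> K * norm z ^ 2 / (norm z / 2)"
      using le ge that K by (intro frac_le) auto
    also have "\<dots> = 2 * K * norm z" using that by (simp add: power2_eq_square)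
    finally show ?thesis .
  qed
  show thesis using that[of r c "2 * K"] r c K 1 2 4 by auto
qed

end

subsection \<open>Backward orbits\<close>

text \<open>Words of length \<open>n\<close>, padded by the principal branch so that they lie among
  the eventually zero words.\<close>

definition words_upto :: "nat \<Rightarrow> nat \<Rightarrow> (nat \<Rightarrow> nat) set" where
  "words_upto d n = {\<sigma> \<in> {1..} \<rightarrow>\<^sub>E {..<d}. \<forall>k>n. \<sigma> k = 0}"

lemma words_upto_0: "d > 0 \<Longrightarrow> words_upto d 0 = {\<lambda>k. if k = 0 then undefined else 0}"
  by (auto simp: words_upto_def PiE_iff extensional_def fun_eq_iff)

lemma bij_betw_words_upto_Suc:
  assumes "d > 0"
  shows "bij_betw (\<lambda>(\<sigma>, i). \<sigma>(Suc n := i)) (words_upto d n \<times> {..<d}) (words_upto d (Suc n))"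
proof (rule bij_betwI[where g = "\<lambda>\<sigma>. (\<sigma>(Suc n := 0), \<sigma> (Suc n))"], goal_cases)
  case 1
  then show ?case by (auto simp: words_upto_def PiE_iff extensional_def)
next
  case 2
  then show ?case using assms by (auto simp: words_upto_def PiE_iff extensional_def)
next
  case (3 p)
  then show ?case by (cases p) (auto simp: words_upto_def fun_eq_iff)
qed auto

lemma finite_words_upto: "d > 0 \<Longrightarrow> finite (words_upto d n)"
proof (induction n)
  case (Suc n)
  then show ?case using bij_betw_finite[OF bij_betw_words_upto_Suc[of d n]] by simp
qed (simp add: words_upto_0)

lemma card_words_upto: "d > 0 \<Longrightarrow> card (words_upto d n) = d ^ n"
proof (induction n)
  case (Suc n)
  then show ?case using bij_betw_same_card[OF bij_betw_words_upto_Suc[of d n]]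
    by (simp add: card_cartesian_product mult.commute)
qed (simp add: words_upto_0)

lemma prod_words_upto_Suc:
  assumes "d > 0"
  shows "(\<Prod>\<sigma>\<in>words_upto d (Suc n). g \<sigma>) = (\<Prod>\<sigma>\<in>words_upto d n. \<Prod>i<d. g (\<sigma>(Suc n := i)))"
  by (simp add: prod.reindex_bij_betw[OF bij_betw_words_upto_Suc[OF assms, of n], symmetric]
      prod.cartesian_product case_prod_unfold)

text \<open>Convergence in a discrete space means being eventually constant, so every admissible
  word is a finite word padded by zeros.\<close>

lemma eventually_zero_wordsD:
  assumes "\<sigma> \<in> eventually_zero_words d"
  shows "\<exists>N. \<sigma> \<in> words_upto d N" "k > 0 \<Longrightarrow> \<sigma> k < d"
proof -
  have \<sigma>: "\<sigma> \<in> {1..} \<rightarrow>\<^sub>E {..<d}" "\<sigma> \<longlonglongrightarrow> 0"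
    using assms by (auto simp: eventually_zero_words_def)
  then have "eventually (\<lambda>k. \<sigma> k = 0) sequentially"
    by (simp add: tendsto_discrete)
  then show "\<exists>N. \<sigma> \<in> words_upto d N"
    using \<sigma>(1) by (auto simp: words_upto_def eventually_sequentially intro: less_imp_le)
  show "\<sigma> k < d" if "k > 0" using \<sigma>(1) that by (auto simp: PiE_iff)
qed

lemma words_upto_subset: "words_upto d n \<subseteq> eventually_zero_words d"
proof
  fix \<sigma> assume \<sigma>: "\<sigma> \<in> words_upto d n"
  then have "eventually (\<lambda>k. \<sigma> k = 0) sequentially"
    by (auto simp: words_upto_def eventually_sequentially intro!: exI[of _ "Suc n"])
  then have "\<sigma> \<longlonglongrightarrow> 0" by (simp add: tendsto_discrete)
  then show "\<sigma> \<in> eventually_zero_words d"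
    using \<sigma> by (simp add: words_upto_def eventually_zero_words_def)
qed

lemma backward_orbit_cong:
  "(\<And>k. 0 < k \<Longrightarrow> k \<le> n \<Longrightarrow> \<sigma> k = \<tau> k) \<Longrightarrow> backward_orbit R \<sigma> w n = backward_orbit R \<tau> w n"
  by (induction n) auto

section \<open>Factorization of the iterates of P and convergence of backward orbits\<close>

context poincare_function
begin

lemma d_pos: "d > 0" using d_ge_2 by simp

text \<open>The induction hypothesis is applied at \<open>poly P u\<close>, and each of its factors
  is split by \<open>poly_diff_branches\<close>. The value of \<open>C\<close> is left open because
  it cancels on normalizing at \<open>u = b\<close>.\<close>

lemma iterate_minus_eq_prod_orbits:
  "\<exists>C. \<forall>u. (poly P ^^ n) u - w = C * (\<Prod>\<sigma>\<in>words_upto d n. u - backward_orbit R \<sigma> w n)"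
proof (induction n)
  case 0
  show ?case by (auto simp: words_upto_0[OF d_pos] intro: exI[of _ 1])
next
  case (Suc n)
  then obtain C where C: "\<And>u. (poly P ^^ n) u - w = C * (\<Prod>\<sigma>\<in>words_upto d n. u - backward_orbit R \<sigma> w n)"
    by blast
  \<comment> \<open>Overwriting letter \<open>Suc n\<close> does not affect the first
    \<open>n\<close> steps.\<close>
  have orbit: "backward_orbit R (\<sigma>(Suc n := i)) w (Suc n) = R i (backward_orbit R \<sigma> w n)" for \<sigma> i
    using backward_orbit_cong[of n "\<sigma>(Suc n := i)" \<sigma>] by simp
  have "(poly P ^^ Suc n) u - w = C * lead_coeff P ^ card (words_upto d n) * 
     (\<Prod>\<sigma>\<in>words_upto d (Suc n). u - backward_orbit R \<sigma> w (Suc n))" for u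
  proof -
    have "(poly P ^^ Suc n) u - w = (poly P ^^ n) (poly P u) - w"
      by (simp add: funpow_swap1)
    also have "\<dots> = C * (\<Prod>\<sigma>\<in>words_upto d n. lead_coeff P * (\<Prod>i<d. u - R i (backward_orbit R \<sigma> w n)))"
      unfolding C poly_diff_branches ..
    also have "\<dots> = C * lead_coeff P ^ card (words_upto d n) * 
      (\<Prod>\<sigma>\<in>words_upto d n. \<Prod>i<d. u - backward_orbit R (\<sigma>(Suc n := i)) w (Suc n))"
      unfolding orbit by (simp add: prod.distrib)
    finally show ?thesis unfolding prod_words_upto_Suc[OF d_pos] .
  qed
  then show ?case by blast
qed

lemma poly_backward_orbit:
  "\<sigma> \<in> eventually_zero_words d \<Longrightarrow> poly P (backward_orbit R \<sigma> w (Suc n)) = backward_orbit R \<sigma> w n"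
  using eventually_zero_wordsD(2)[of \<sigma> d "Suc n"] by (simp add: poly_branch)

lemma iterate_backward_orbit:
  "\<sigma> \<in> eventually_zero_words d \<Longrightarrow> (poly P ^^ k) (backward_orbit R \<sigma> w (n + k)) = backward_orbit R \<sigma> w n"
  by (induction k) (simp_all add: funpow_swap1 poly_backward_orbit del: backward_orbit.simps)

text \<open>Forward iteration fixes \<open>b\<close>, so an orbit through \<open>b\<close> would
  have to start there.\<close>

lemma backward_orbit_neq_fixed_point:
  assumes "\<sigma> \<in> eventually_zero_words d" "w \<noteq> b"
  shows "backward_orbit R \<sigma> w n \<noteq> b"
proof
  assume "backward_orbit R \<sigma> w n = b"
  then have "(poly P ^^ n) b = w"
    using iterate_backward_orbit[OF assms(1), of n w 0] by simp
  moreover have "(poly P ^^ n) b = b" by (induction n) (simp_all add: fixed_point)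
  ultimately show False using assms by simp
qed

lemma principal_backward_orbit:
  assumes "\<sigma> \<in> words_upto d N"
  shows "backward_orbit R \<sigma> w (N + k) = (R 0 ^^ k) (backward_orbit R \<sigma> w N)"
  using assms by (induction k) (auto simp: words_upto_def)

text \<open>From some index on only the principal branch is applied, and its iterates converge to
  \<open>b\<close> from every starting point.\<close>

lemma backward_orbit_tendsto:
  assumes "\<sigma> \<in> eventually_zero_words d"
  shows "(\<lambda>n. backward_orbit R \<sigma> w n) \<longlonglongrightarrow> b"
proof -
  obtain N where N: "\<sigma> \<in> words_upto d N" using eventually_zero_wordsD(1)[OF assms] by blast
  have "(\<lambda>k. backward_orbit R \<sigma> w (k + N)) \<longlonglongrightarrow> b"
    using principal_attracts by (simp add: add.commute[of _ N] principal_backward_orbit[OF N])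
  then show ?thesis by (rule LIMSEQ_offset)
qed

lemma inverse_powers_tendsto_0: "(\<lambda>n. z / a ^ n) \<longlonglongrightarrow> 0"
proof -
  have "(\<lambda>n. z * inverse a ^ n) \<longlonglongrightarrow> z * 0"
    by (intro tendsto_intros LIMSEQ_power_zero) (use repelling in \<open>simp add: norm_inverse inverse_less_1_iff\<close>)
  then show ?thesis by (simp add: power_inverse divide_inverse)
qed

text \<open>This is \<open>deriv f 0 = 1\<close>, read along the difference quotients at
  \<open>z / a ^ n\<close>.\<close>

lemma rescaled_tendsto: "(\<lambda>n. a ^ n * (f (z / a ^ n) - b)) \<longlonglongrightarrow> z"
proof (cases "z = 0")
  case False
  have "((\<lambda>h. (f h - b) / h) \<longlongrightarrow> 1) (at 0)"
    using f_has_deriv[of 0] by (simp add: DERIV_def f_0 deriv_f_0)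
  moreover have "filterlim (\<lambda>n. z / a ^ n) (at 0) sequentially"
    using inverse_powers_tendsto_0 False a_nonzero by (simp add: filterlim_at)
  ultimately have "(\<lambda>n. (f (z / a ^ n) - b) / (z / a ^ n)) \<longlonglongrightarrow> 1"
    by (rule filterlim_compose)
  then have "(\<lambda>n. z * ((f (z / a ^ n) - b) / (z / a ^ n))) \<longlonglongrightarrow> z * 1"
    by (intro tendsto_intros)
  then show ?thesis using False by (simp add: mult.commute)
qed (simp add: f_0)

lemma norm_divide_power_le: "norm (z / a ^ n) \<le> norm z"
proof -
  have "norm a ^ n \<ge> 1" using repelling by simp
  then have "norm z * 1 \<le> norm z * norm a ^ n" by (intro mult_left_mono) auto
  moreover have "norm a ^ n > 0" using a_nonzero by simp
  ultimately show ?thesis by (simp add: norm_divide norm_power divide_le_eq)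
qed

end

text \<open>The constants \<open>r\<close>, \<open>c\<close>, \<open>K\<close> are those supplied by
  \<open>local_linearization\<close>, fixed here so that all later estimates share them.\<close>

locale poincare_point = poincare_function +
  fixes w :: complex and r c K :: real
  assumes w_neq: "w \<noteq> b" and r_pos: "r > 0" and c_pos: "c > 0" and K_pos: "K > 0"
    and principal_conj: "\<And>z. norm z < r \<Longrightarrow> R 0 (f z) = f (z / a)"
    and principal_unique: "\<And>z i. norm z < r \<Longrightarrow> i < d \<Longrightarrow> R i (f z) = f (z / a) \<Longrightarrow> i = 0"
    and local_onto: "\<And>u. norm (u - b) < c \<Longrightarrow> \<exists>z. norm z < r \<and> f z = u"
    and near_linear: "\<And>z. norm z < r \<Longrightarrow> z \<noteq> 0 \<Longrightarrow> norm (z / (f z - b) - 1) \<le> K * norm z"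
begin

section \<open>Words as labels of solutions of f z = w\<close>

abbreviation orb :: "(nat \<Rightarrow> nat) \<Rightarrow> nat \<Rightarrow> complex" where
  "orb \<sigma> n \<equiv> backward_orbit R \<sigma> w n"

abbreviation words :: "(nat \<Rightarrow> nat) set" where "words \<equiv> eventually_zero_words d"

lemma principal_conj_iterate:
  assumes "norm z < r"
  shows "(R 0 ^^ k) (f z) = f (z / a ^ k)"
proof (induction k)
  case (Suc k)
  have "norm (z / a ^ k) < r" using assms norm_divide_power_le[of z k] by simp
  then show ?case using Suc principal_conj[of "z / a ^ k"] by (simp add: mult.commute)
qed simp

text \<open>At a late index \<open>M\<close> the orbit is \<open>f z\<close> with \<open>z\<close>
  in the linearization disc. Beyond \<open>M\<close> the principal branch divides by
  \<open>a\<close>; before \<open>M\<close> forward iteration of \<open>P\<close> multiplies by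
  \<open>a\<close>. So \<open>a ^ M * z\<close> is the required point.\<close>

lemma ex_preimage:
  assumes "\<sigma> \<in> words"
  shows "\<exists>z. \<forall>n. orb \<sigma> n = f (z / a ^ n)"
proof -
  obtain N where N: "\<sigma> \<in> words_upto d N" using eventually_zero_wordsD(1)[OF assms] by blast
  have "eventually (\<lambda>n. dist (orb \<sigma> n) b < c) sequentially"
    using backward_orbit_tendsto[OF assms] c_pos by (rule tendstoD)
  then obtain M0 where M0: "\<And>n. n \<ge> M0 \<Longrightarrow> dist (orb \<sigma> n) b < c"
    by (auto simp: eventually_sequentially)
  \<comment> \<open>Late enough that all further letters are 0 and the orbit is within
    \<open>c\<close> of \<open>b\<close>.\<close>
  define M where "M = max M0 N"
  have M: "M \<ge> N" "dist (orb \<sigma> M) b < c" using M0[of M] by (auto simp: M_def)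
  then obtain z where z: "norm z < r" "f z = orb \<sigma> M"
    using local_onto[of "orb \<sigma> M"] by (auto simp: dist_norm)
  have MM: "\<sigma> \<in> words_upto d M" using N M by (auto simp: words_upto_def)
  have "orb \<sigma> n = f (a ^ M * z / a ^ n)" for n
  proof (cases "n \<ge> M")
    case True
    then obtain k where k: "n = M + k" using le_Suc_ex by blast
    show ?thesis
      using principal_backward_orbit[OF MM, of w k] principal_conj_iterate[OF z(1), of k] a_nonzero
      by (simp add: k z power_add)
  next
    case False
    then obtain k where k: "M = n + k" using le_Suc_ex by (metis nat_le_linear)
    have "orb \<sigma> n = (poly P ^^ k) (f z)"
      using iterate_backward_orbit[OF assms, of k w n] by (simp add: z k)
    then show ?thesis using a_nonzero by (simp add: P_iterate_f k power_add)
  qed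
  then show ?thesis by blast
qed

text \<open>The choice is unambiguous: by \<open>rescaled_tendsto\<close> such a point must be the
  limit of \<open>a ^ n * (orb \<sigma> n - b)\<close>.\<close>

definition zeta :: "(nat \<Rightarrow> nat) \<Rightarrow> complex" where
  "zeta \<sigma> = (SOME z. \<forall>n. orb \<sigma> n = f (z / a ^ n))"

lemma orb_eq: "\<sigma> \<in> words \<Longrightarrow> orb \<sigma> n = f (zeta \<sigma> / a ^ n)"
  unfolding zeta_def using someI_ex[OF ex_preimage] by blast

lemma zeta_tendsto: "\<sigma> \<in> words \<Longrightarrow> (\<lambda>n. a ^ n * (orb \<sigma> n - b)) \<longlonglongrightarrow> zeta \<sigma>"
  using rescaled_tendsto by (simp add: orb_eq)

lemma f_zeta: "\<sigma> \<in> words \<Longrightarrow> f (zeta \<sigma>) = w"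
  using orb_eq[of \<sigma> 0] by simp

text \<open>Near 0 the values of \<open>f\<close> are close to \<open>b\<close>, hence different
  from \<open>w\<close>.\<close>

lemma zeta_bounded_below:
  obtains \<delta> where "\<delta> > 0" "\<And>\<sigma>. \<sigma> \<in> words \<Longrightarrow> norm (zeta \<sigma>) \<ge> \<delta>"
proof -
  obtain \<delta> where \<delta>: "\<delta> > 0" "\<And>z. dist z 0 < \<delta> \<Longrightarrow> dist (f z) (f 0) < dist w b"
    using isCont_f[of 0] w_neq unfolding continuous_at_eps_delta by (metis zero_less_dist_iff)
  have "norm (zeta \<sigma>) \<ge> \<delta>" if "\<sigma> \<in> words" for \<sigma>
    using \<delta>(2)[of "zeta \<sigma>"] f_zeta[OF that] f_0 by (auto simp: not_less[symmetric])
  then show thesis using \<delta> that by blast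
qed

lemma zeta_nonzero: "\<sigma> \<in> words \<Longrightarrow> zeta \<sigma> \<noteq> 0"
  using f_zeta[of \<sigma>] f_0 w_neq by auto

text \<open>The telescoping divides by \<open>orb \<sigma> n - b\<close>, which is nonzero because a
  backward orbit of \<open>w\<close> never meets \<open>b\<close>.\<close>

lemma prod_quot_poly:
  assumes "\<sigma> \<in> words"
  shows "(\<Prod>k<n. poly (quot_poly P b) (orb \<sigma> (Suc k)) / a) = (w - b) / (a ^ n * (orb \<sigma> n - b))"
proof (induction n)
  case (Suc n)
  have "poly (P - [:b:]) (orb \<sigma> (Suc n)) = poly (quot_poly P b) (orb \<sigma> (Suc n)) * (orb \<sigma> (Suc n) - b)"
    unfolding quot_poly_mult[OF fixed_point] by (simp add: algebra_simps)
  then have "orb \<sigma> n - b = poly (quot_poly P b) (orb \<sigma> (Suc n)) * (orb \<sigma> (Suc n) - b)"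
    by (simp add: poly_backward_orbit[OF assms] del: backward_orbit.simps)
  moreover have nz: "orb \<sigma> n - b \<noteq> 0" "orb \<sigma> (Suc n) - b \<noteq> 0"
    using backward_orbit_neq_fixed_point[OF assms w_neq] by (simp_all del: backward_orbit.simps)
  ultimately have "poly (quot_poly P b) (orb \<sigma> (Suc n)) = (orb \<sigma> n - b) / (orb \<sigma> (Suc n) - b)"
    by (metis nonzero_mult_div_cancel_right)
  moreover have "(w - b) / (a ^ n * x) * (x / y / a) = (w - b) / (a ^ Suc n * y)" if "x \<noteq> 0" for x y
    using that a_nonzero by simp
  ultimately show ?case using Suc nz
    by (simp only: prod.lessThan_Suc)
qed (use w_neq in simp)

text \<open>A zero factor would make a partial product vanish, against its telescoped value.\<close>

lemma quot_poly_orb_nonzero: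
  assumes "\<sigma> \<in> words"
  shows "poly (quot_poly P b) (orb \<sigma> (Suc k)) \<noteq> 0"
proof
  assume "poly (quot_poly P b) (orb \<sigma> (Suc k)) = 0"
  then have "(\<Prod>k<Suc k. poly (quot_poly P b) (orb \<sigma> (Suc k)) / a) = 0" by simp
  then show False unfolding prod_quot_poly[OF assms]
    using w_neq a_nonzero backward_orbit_neq_fixed_point[OF assms w_neq] by (simp del: backward_orbit.simps)
qed

text \<open>With nonzero factors, convergence of the product means that the partial products have a
  nonzero limit; here the limit is \<open>((w - b) / zeta \<sigma>) ^ m\<close>.\<close>

lemma orbit_product:
  assumes "\<sigma> \<in> words"
  shows "convergent_prod (\<lambda>n. poly (quot_poly P b) (orb \<sigma> (Suc n)) ^ m / a ^ m)" (is ?conv)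
    and "(\<Prod>n. poly (quot_poly P b) (orb \<sigma> (Suc n)) ^ m / a ^ m) = (w - b) ^ m * (1 / zeta \<sigma>) ^ m" (is ?lim)
proof -
  let ?g = "\<lambda>n. poly (quot_poly P b) (orb \<sigma> (Suc n)) ^ m / a ^ m"
  have prod_eq: "(\<Prod>k<n. ?g k) = ((w - b) / (a ^ n * (orb \<sigma> n - b))) ^ m" for n
    unfolding prod_quot_poly[OF assms, symmetric] prod_power_distrib power_divide ..
  have "(\<lambda>n. \<Prod>k<n. ?g k) \<longlonglongrightarrow> ((w - b) / zeta \<sigma>) ^ m"
    unfolding prod_eq by (intro tendsto_intros zeta_tendsto zeta_nonzero assms)
  then have lim: "(\<lambda>n. \<Prod>k\<le>n. ?g k) \<longlonglongrightarrow> ((w - b) / zeta \<sigma>) ^ m"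
    by (simp only: LIMSEQ_lessThan_iff_atMost)
  have nz: "((w - b) / zeta \<sigma>) ^ m \<noteq> 0" using w_neq zeta_nonzero[OF assms] by simp
  have "?g k \<noteq> 0" for k using quot_poly_orb_nonzero[OF assms] a_nonzero by (simp del: backward_orbit.simps)
  then show ?conv using lim nz convergent_prod_iff_nz_lim[of ?g] by blast
  show ?lim using prodinf_eq_prod_lim[OF lim nz] by (simp add: power_divide)
qed

text \<open>The condition says that \<open>zeta \<sigma> / a ^ n\<close> lies in the linearization
  disc, that is, the orbit has entered the linear regime after \<open>n\<close> steps.\<close>

definition near :: "nat \<Rightarrow> (nat \<Rightarrow> nat) set" where
  "near n = {\<sigma> \<in> words. norm (zeta \<sigma>) < r * norm a ^ n}"

text \<open>Inside the linearization disc each step leads from \<open>f z\<close> to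
  \<open>f (z / a)\<close>, and only the branch 0 does that. Hence \<open>near n\<close> is finite,
  with at most \<open>d ^ n\<close> elements.\<close>

lemma near_subset_words_upto: "near n \<subseteq> words_upto d n"
proof
  fix \<sigma> assume "\<sigma> \<in> near n"
  then have \<sigma>: "\<sigma> \<in> words" "norm (zeta \<sigma>) < r * norm a ^ n" by (auto simp: near_def)
  have "\<sigma> k = 0" if "k > n" for k
  proof -
    define l where "l = k - Suc n"
    then have l: "k = Suc (n + l)" using that by simp
    have "norm (zeta \<sigma> / a ^ n) < r"
      using \<sigma>(2) a_nonzero by (simp add: norm_divide norm_power divide_less_eq)
    then have "norm (zeta \<sigma> / a ^ (n + l)) < r"
      using norm_divide_power_le[of "zeta \<sigma> / a ^ n" l] by (simp add: power_add)
    moreover have "\<sigma> k < d" using eventually_zero_wordsD(2)[OF \<sigma>(1)] l by simp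
    moreover have "R (\<sigma> k) (f (zeta \<sigma> / a ^ (n + l))) = f (zeta \<sigma> / a ^ (n + l) / a)"
      using orb_eq[OF \<sigma>(1), of "Suc (n + l)"] orb_eq[OF \<sigma>(1), of "n + l"] by (simp add: l mult.commute)
    ultimately show ?thesis by (rule principal_unique)
  qed
  then show "\<sigma> \<in> words_upto d n"
    using \<sigma> by (auto simp: words_upto_def eventually_zero_words_def)
qed

lemma finite_near: "finite (near n)"
  using near_subset_words_upto finite_words_upto[OF d_pos] by (rule finite_subset)

lemma card_near_le: "card (near n) \<le> d ^ n"
  using card_mono[OF finite_words_upto[OF d_pos] near_subset_words_upto] card_words_upto[OF d_pos] by metis

text \<open>If \<open>orb \<sigma> n\<close> were within \<open>c\<close> of \<open>b\<close>, it
  would be \<open>f z\<close> with \<open>norm z < r\<close>. As all later letters are 0, the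
  rescaled limit would give \<open>zeta \<sigma> = a ^ n * z\<close>, which puts the word into
  \<open>near n\<close>.\<close>

lemma far_orb:
  assumes "\<sigma> \<in> words_upto d n - near n"
  shows "norm (orb \<sigma> n - b) \<ge> c"
proof (rule ccontr)
  assume "\<not> norm (orb \<sigma> n - b) \<ge> c"
  then obtain z where z: "norm z < r" "f z = orb \<sigma> n"
    using local_onto[of "orb \<sigma> n"] by auto
  have \<sigma>: "\<sigma> \<in> words" using assms words_upto_subset by blast
  have "a ^ (n + k) * (orb \<sigma> (n + k) - b) = a ^ n * (a ^ k * (f (z / a ^ k) - b))" for k
    using principal_backward_orbit[of \<sigma> n w k] principal_conj_iterate[OF z(1), of k] assms
    by (simp add: z power_add)
  moreover have "(\<lambda>k. a ^ n * (a ^ k * (f (z / a ^ k) - b))) \<longlonglongrightarrow> a ^ n * z"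
    by (intro tendsto_intros rescaled_tendsto)
  moreover have "(\<lambda>k. a ^ (n + k) * (orb \<sigma> (n + k) - b)) \<longlonglongrightarrow> zeta \<sigma>"
    using LIMSEQ_ignore_initial_segment[OF zeta_tendsto[OF \<sigma>], of n] by (simp only: add.commute)
  ultimately have "zeta \<sigma> = a ^ n * z" using LIMSEQ_unique by force
  then have "norm (zeta \<sigma>) < r * norm a ^ n"
    using z(1) a_nonzero by (simp add: norm_mult norm_power mult.commute)
  then show False using assms \<sigma> by (simp add: near_def)
qed

end

subsection \<open>Power sums\<close>

lemma bell_poly_cong:
  "(\<And>i. i \<ge> 1 \<Longrightarrow> x i = y i) \<Longrightarrow> bell_poly m j x = bell_poly m j y"
  by (simp add: bell_poly_def)

section \<open>Taylor coefficients of f at 0\<close>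

context poincare_function
begin

text \<open>Subtracting \<open>b\<close> removes the constant coefficient, so the series can be
  substituted into others and its powers yield Bell polynomials.\<close>

definition f_series :: "complex fps" where "f_series = fps_expansion f 0 - fps_const b"

lemma has_fps_expansion_f_series: "(\<lambda>z. f z - b) has_fps_expansion f_series"
  unfolding f_series_def
  by (intro fps_expansion_intros has_fps_expansion_fps_expansion[of UNIV]) (use holo in auto)

lemma f_series_nth: "f_series $ n = (if n = 0 then 0 else (deriv ^^ n) f 0 / fact n)"
  by (simp add: f_series_def fps_expansion_def f_0)

lemma f_series_nth_0 [simp]: "f_series $ 0 = 0" and f_series_nth_1 [simp]: "f_series $ Suc 0 = 1"
  by (simp_all add: f_series_nth deriv_f_0)

lemma f_series_power_nth_self [simp]: "(f_series ^ m) $ m = 1"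
  by (simp add: startsby_zero_power_nth_same)

lemma f_series_power_nth:
  assumes "j \<le> m"
  shows "(f_series ^ j) $ m = fact j / fact m * bell_poly m j (\<lambda>i. (deriv ^^ i) f 0)"
proof -
  have "bell_poly m j (\<lambda>i. fact i * f_series $ i) = bell_poly m j (\<lambda>i. (deriv ^^ i) f 0)"
    by (rule bell_poly_cong) (simp add: f_series_nth)
  then show ?thesis using fps_power_nth_bell_poly[OF f_series_nth_0 assms] by simp
qed

lemma has_fps_expansion_rescaled:
  "(\<lambda>z. f (c * z) - b) has_fps_expansion (f_series oo (fps_const c * fps_X))"
proof -
  have "((\<lambda>z. f z - b) \<circ> (\<lambda>z. c * z)) has_fps_expansion (f_series oo (fps_const c * fps_X))"
    by (intro has_fps_expansion_compose has_fps_expansion_f_series fps_expansion_intros) auto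
  then show ?thesis by (simp add: o_def)
qed

text \<open>Compares coefficients in \<open>f (a * z) = poly P (f z)\<close>, with \<open>P\<close>
  expanded in powers of \<open>f z - b\<close>.\<close>

lemma f_series_nth_recurrence:
  assumes "m \<ge> 1"
  shows "a ^ m * f_series $ m = (\<Sum>j=1..m. poly ((pderiv ^^ j) P) b / fact j * (f_series ^ j) $ m)"
proof -
  define q where "q = pcompose P [:b, 1:]"
  have eq: "f (a * z) - b = (\<Sum>j\<le>degree q. coeff q j * (f z - b) ^ j) - b" for z
  proof -
    have "f (a * z) = poly q (f z - b)" by (simp add: functional_eq q_def poly_pcompose)
    then show ?thesis by (simp add: poly_altdef)
  qed
  have "(\<lambda>z. f (a * z) - b) has_fps_expansion 
      ((\<Sum>j\<le>degree q. fps_const (coeff q j) * f_series ^ j) - fps_const b)"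
    unfolding eq by (intro fps_expansion_intros has_fps_expansion_f_series)
  then have "f_series oo (fps_const a * fps_X) = (\<Sum>j\<le>degree q. fps_const (coeff q j) * f_series ^ j) - fps_const b"
    using has_fps_expansion_rescaled[of a] fps_expansion_unique_complex by blast
  then have "(f_series oo (fps_const a * fps_X)) $ m = ((\<Sum>j\<le>degree q. fps_const (coeff q j) * f_series ^ j) - fps_const b) $ m"
    by simp
  then have "a ^ m * f_series $ m = (\<Sum>j\<le>degree q. coeff q j * (f_series ^ j) $ m)"
    using assms by (simp add: fps_sum_nth)
  \<comment> \<open>The power \<open>j = 0\<close> is constant, powers with \<open>j > m\<close>
    start beyond degree \<open>m\<close>, and coefficients of \<open>q\<close> vanish beyond its
    degree.\<close>
  also have "\<dots> = (\<Sum>j\<in>{1..m}. coeff q j * (f_series ^ j) $ m)"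
  proof -
    have "(f_series ^ j) $ m = 0" if "j \<notin> {1..m}" for j
      using that assms startsby_zero_power_prefix[OF f_series_nth_0, of j]
      by (cases "j = 0") auto
    moreover have "coeff q j = 0" if "j > degree q" for j
      using that by (rule coeff_eq_0)
    ultimately show ?thesis
      by (intro sum.mono_neutral_cong) (auto simp: not_le)
  qed
  finally show ?thesis by (simp add: q_def coeff_pcompose_shift)
qed

text \<open>The term \<open>j = 1\<close> of the previous recurrence is
  \<open>a * f_series $ m\<close> and moves to the left; \<open>a ^ m\<close> differs from
  \<open>a\<close> because \<open>norm a > 1\<close>. For \<open>j \<ge> 2\<close> only derivatives
  of order below \<open>m\<close> remain.\<close>

lemma higher_deriv_recurrence:
  assumes "m \<ge> 2"
  shows "(deriv ^^ m) f 0 = inverse (a ^ m - a) *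
    (\<Sum>j=2..m. poly ((pderiv ^^ j) P) b * bell_poly m j (\<lambda>i. (deriv ^^ i) f 0))"
proof -
  have "norm a ^ 1 < norm a ^ m" using repelling assms by (intro power_strict_increasing) auto
  then have nz: "a ^ m - a \<noteq> 0" by (auto simp flip: norm_power)
  have "{1..m} = insert 1 {2..m}" using assms by auto
  then have "a ^ m * f_series $ m = a * f_series $ m + (\<Sum>j=2..m. poly ((pderiv ^^ j) P) b / fact j * (f_series ^ j) $ m)"
    using f_series_nth_recurrence[of m] assms multiplier by simp
  then have "(a ^ m - a) * (fact m * f_series $ m) = fact m * (\<Sum>j=2..m. poly ((pderiv ^^ j) P) b / fact j * (f_series ^ j) $ m)"
    by (simp add: algebra_simps)
  also have "\<dots> = (\<Sum>j=2..m. poly ((pderiv ^^ j) P) b * bell_poly m j (\<lambda>i. (deriv ^^ i) f 0))"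
    unfolding sum_distrib_left by (intro sum.cong refl) (simp add: f_series_power_nth)
  finally show ?thesis using nz assms by (simp add: f_series_nth field_simps)
qed

lemma bell_poly_2_2: "bell_poly 2 2 (\<lambda>i. (deriv ^^ i) f 0) = 1"
  using f_series_power_nth[of 2 2] by simp

lemma bell_poly_1: "m \<ge> 1 \<Longrightarrow> bell_poly m 1 (\<lambda>i. (deriv ^^ i) f 0) = (deriv ^^ m) f 0"
  using f_series_power_nth[of 1 m] by (simp add: f_series_nth)

end

section \<open>Limits of the power sums over words of length n\<close>

context poincare_point
begin

definition power_sum :: "nat \<Rightarrow> nat \<Rightarrow> complex" where
  "power_sum n m = (\<Sum>\<sigma>\<in>words_upto d n. (1 / (a ^ n * (orb \<sigma> n - b))) ^ m)"

text \<open>This is \<open>m\<close> times the coefficient of \<open>z ^ m\<close> in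
  \<open>- log (1 - (f z - b) / (w - b))\<close>.\<close>

definition moment :: "nat \<Rightarrow> complex" where
  "moment m = of_nat m * (\<Sum>j=1..m. (1 / (w - b)) ^ j / of_nat j * (f_series ^ j) $ m)"

lemma orb_neq: "\<sigma> \<in> words_upto d n \<Longrightarrow> orb \<sigma> k \<noteq> b"
  using backward_orbit_neq_fixed_point words_upto_subset w_neq by blast

text \<open>The factorization of the \<open>n\<close>-th iterate minus \<open>w\<close> is taken at
  \<open>f (z / a ^ n)\<close>, which the iterate sends to \<open>f z\<close>, and divided by its
  value at \<open>b\<close>. All factors involve the same function of \<open>z\<close>, as
  \<open>log_series_compose_prod\<close> requires.\<close>

lemma f_factorization:
  "1 - 1 / (w - b) * (f z - b) =
    (\<Prod>\<sigma>\<in>words_upto d n. 1 - 1 / (a ^ n * (orb \<sigma> n - b)) * (a ^ n * (f (1 / a ^ n * z) - b)))"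
proof -
  obtain C where C: "\<And>u. (poly P ^^ n) u - w = C * (\<Prod>\<sigma>\<in>words_upto d n. u - orb \<sigma> n)"
    using iterate_minus_eq_prod_orbits by blast
  have Pb: "(poly P ^^ n) b = b" by (induction n) (simp_all add: fixed_point)
  have "(poly P ^^ n) (f (1 / a ^ n * z)) = f z" using a_nonzero by (simp add: P_iterate_f)
  then have 1: "f z - w = C * (\<Prod>\<sigma>\<in>words_upto d n. f (1 / a ^ n * z) - orb \<sigma> n)"
    using C[of "f (1 / a ^ n * z)"] by simp
  have 2: "b - w = C * (\<Prod>\<sigma>\<in>words_upto d n. b - orb \<sigma> n)"
    using C[of b] Pb by simp
  have "1 - 1 / (w - b) * (f z - b) = (f z - w) / (b - w)"
    using w_neq by (simp add: divide_simps) (simp add: algebra_simps)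
  also have "\<dots> = (\<Prod>\<sigma>\<in>words_upto d n. (f (1 / a ^ n * z) - orb \<sigma> n) / (b - orb \<sigma> n))"
  proof -
    have "C \<noteq> 0" using 2 w_neq by auto
    then show ?thesis by (simp add: 1 2 prod_dividef)
  qed
  also have "\<dots> = (\<Prod>\<sigma>\<in>words_upto d n. 1 - 1 / (a ^ n * (orb \<sigma> n - b)) * (a ^ n * (f (1 / a ^ n * z) - b)))"
  proof (rule prod.cong)
    fix \<sigma> assume "\<sigma> \<in> words_upto d n"
    then have "orb \<sigma> n \<noteq> b" by (rule orb_neq)
    then have "(u - orb \<sigma> n) / (b - orb \<sigma> n) = 1 - 1 / (A * (orb \<sigma> n - b)) * (A * (u - b))" if "A \<noteq> 0" for u A
      using that by (simp add: divide_simps) (simp add: algebra_simps)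
    then show "(f (1 / a ^ n * z) - orb \<sigma> n) / (b - orb \<sigma> n) = 
      1 - 1 / (a ^ n * (orb \<sigma> n - b)) * (a ^ n * (f (1 / a ^ n * z) - b))"
      using a_nonzero by simp
  qed simp
  finally show ?thesis .
qed

text \<open>Coefficient \<open>m\<close> of the logarithm of \<open>f_factorization\<close>; the
  terms \<open>j = 0\<close> vanish through division by zero. The series \<open>\<phi>\<close>
  expands \<open>a ^ n * (f (z / a ^ n) - b)\<close>.\<close>

lemma power_sum_identity:
  "(\<Sum>j=0..m. (1 / (w - b)) ^ j / of_nat j * (f_series ^ j) $ m) =
   (\<Sum>j=0..m. power_sum n j / of_nat j * (a ^ n) ^ j * (1 / a ^ n) ^ m * (f_series ^ j) $ m)"
proof -
  define L where "L = fps_const (1 / a ^ n) * (fps_X :: complex fps)"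
  define \<phi> where "\<phi> = fps_const (a ^ n) * (f_series oo L)"
  have L0: "L $ 0 = 0" by (simp add: L_def)
  have "(\<lambda>z. 1 - 1 / (w - b) * (f z - b)) has_fps_expansion 1 - fps_const (1 / (w - b)) * f_series"
    by (intro fps_expansion_intros has_fps_expansion_f_series)
  moreover have "(\<lambda>z. 1 - 1 / (w - b) * (f z - b)) has_fps_expansion
     (\<Prod>\<sigma>\<in>words_upto d n. 1 - fps_const (1 / (a ^ n * (orb \<sigma> n - b))) * \<phi>)"
    unfolding f_factorization[of _ n] \<phi>_def L_def
    by (intro fps_expansion_intros has_fps_expansion_rescaled)
  ultimately have "1 - fps_const (1 / (w - b)) * f_series =
     (\<Prod>\<sigma>\<in>words_upto d n. 1 - fps_const (1 / (a ^ n * (orb \<sigma> n - b))) * \<phi>)"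
    using fps_expansion_unique_complex by blast
  then have "log_series (1 / (w - b)) oo f_series =
     (\<Sum>\<sigma>\<in>words_upto d n. log_series (1 / (a ^ n * (orb \<sigma> n - b)))) oo \<phi>"
    by (intro log_series_compose_prod finite_words_upto d_pos) (auto simp: \<phi>_def)
  then have "(log_series (1 / (w - b)) oo f_series) $ m =
     ((\<Sum>\<sigma>\<in>words_upto d n. log_series (1 / (a ^ n * (orb \<sigma> n - b)))) oo \<phi>) $ m"
    by simp
  moreover have "(\<phi> ^ j) $ m = (a ^ n) ^ j * ((1 / a ^ n) ^ m * (f_series ^ j) $ m)" for j
  proof -
    have "\<phi> ^ j = fps_const ((a ^ n) ^ j) * (f_series ^ j oo L)"
      by (simp add: \<phi>_def power_mult_distrib fps_const_power fps_compose_power[OF L0])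
    then show ?thesis by (simp add: L_def)
  qed
  moreover have "(\<Sum>\<sigma>\<in>words_upto d n. log_series (1 / (a ^ n * (orb \<sigma> n - b)))) $ j = power_sum n j / of_nat j" for j
    by (simp add: fps_sum_nth log_series_def power_sum_def sum_divide_distrib)
  moreover have "log_series s $ j = s ^ j / of_nat j" for s :: complex and j
    by (simp add: log_series_def)
  ultimately show ?thesis by (simp add: fps_compose_nth mult.assoc)
qed

text \<open>In \<open>power_sum_identity\<close> the term \<open>j = m\<close> is
  \<open>power_sum n m / m\<close>, while a term with \<open>j < m\<close> is a convergent power sum
  times \<open>(1 / a ^ n) ^ (m - j)\<close> and a constant, so it tends to 0.\<close>

lemma power_sum_tendsto: "m \<ge> 1 \<Longrightarrow> (\<lambda>n. power_sum n m) \<longlonglongrightarrow> moment m"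
proof (induction m rule: less_induct)
  case (less m)
  define G where "G = (\<lambda>j n. power_sum n j / of_nat j * (a ^ n) ^ j * (1 / a ^ n) ^ m * (f_series ^ j) $ m)"
  have split: "{0..m} = insert 0 {1..m}" "{1..m} = insert m {1..<m}" using less.prems by auto
  have lim: "G j \<longlonglongrightarrow> 0" if "j \<in> {1..<m}" for j
  proof -
    have "(\<lambda>n. power_sum n j / of_nat j * (1 / a ^ n) ^ (m - j) * (f_series ^ j) $ m) 
      \<longlonglongrightarrow> moment j / of_nat j * 0 ^ (m - j) * (f_series ^ j) $ m"
      by (intro tendsto_intros less.IH inverse_powers_tendsto_0) (use that in auto)
    moreover
    have "G j n = power_sum n j / of_nat j * (1 / a ^ n) ^ (m - j) * (f_series ^ j) $ m" for n
    proof -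
      have "(1 / a ^ n) ^ m = (1 / a ^ n) ^ (m - j) * (1 / a ^ n) ^ j"
        using that by (simp flip: power_add)
      then have "(a ^ n) ^ j * (1 / a ^ n) ^ m = (1 / a ^ n) ^ (m - j)"
        using a_nonzero by (simp add: power_divide)
      moreover
    have "G j n = power_sum n j / of_nat j * ((a ^ n) ^ j * (1 / a ^ n) ^ m) * (f_series ^ j) $ m"
        by (simp only: G_def mult.assoc)
      ultimately show ?thesis by simp
    qed
    then have "G j = (\<lambda>n. power_sum n j / of_nat j * (1 / a ^ n) ^ (m - j) * (f_series ^ j) $ m)"
      by (rule ext)
    ultimately show ?thesis using that by (simp add: zero_power)
  qed
  have eq: "moment m / of_nat m = power_sum n m / of_nat m + (\<Sum>j\<in>{1..<m}. G j n)" for n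
  proof -
    have "moment m / of_nat m = (\<Sum>j=0..m. (1 / (w - b)) ^ j / of_nat j * (f_series ^ j) $ m)"
      using less.prems by (simp add: moment_def split(1))
    also have "\<dots> = (\<Sum>j=0..m. G j n)"
      unfolding G_def by (rule power_sum_identity)
    also have "\<dots> = G m n + (\<Sum>j\<in>{1..<m}. G j n)"
      using less.prems unfolding split by (simp add: G_def)
    also have "G m n = power_sum n m / of_nat m" 
      using a_nonzero by (simp add: G_def power_divide)
    finally show ?thesis .
  qed
  have "(\<lambda>n. of_nat m * (moment m / of_nat m - (\<Sum>j\<in>{1..<m}. G j n))) 
     \<longlonglongrightarrow> of_nat m * (moment m / of_nat m - (\<Sum>j\<in>{1..<m}. 0))"
    by (intro tendsto_intros lim)
  moreover have "power_sum n m = of_nat m * (moment m / of_nat m - (\<Sum>j\<in>{1..<m}. G j n))" for n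
    unfolding eq[of n] using less.prems by simp
  ultimately show ?case using less.prems by simp
qed

text \<open>Words whose orbit is still far from \<open>b\<close> after \<open>n\<close> steps contribute \<open>O((d / |a|)^n)\<close>: this is
  where \<open>d < |a|\<close> enters.\<close>

lemma near_sum_tendsto:
  assumes "m \<ge> 1"
  shows "(\<lambda>n. \<Sum>\<sigma>\<in>near n. (1 / zeta \<sigma>) ^ m) \<longlonglongrightarrow> moment m"
proof -
  obtain \<delta> where \<delta>: "\<delta> > 0" "\<And>\<sigma>. \<sigma> \<in> words \<Longrightarrow> norm (zeta \<sigma>) \<ge> \<delta>"
    using zeta_bounded_below by blast
  \<comment> \<open>With \<open>h = z / (f z - b)\<close>, the estimate for \<open>h\<close> passes
    to powers through \<open>h ^ Suc m - 1 = h * (h ^ m - 1) + (h - 1)\<close>.\<close>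
  obtain M where M: "M \<ge> 0" "\<And>z. norm z < r \<Longrightarrow> z \<noteq> 0 \<Longrightarrow> norm ((z / (f z - b)) ^ m - 1) \<le> M * norm z"
  proof -
    have "\<exists>M\<ge>0. \<forall>z. norm z < r \<longrightarrow> z \<noteq> 0 \<longrightarrow> norm ((z / (f z - b)) ^ m - 1) \<le> M * norm z" for m
    proof (induction m)
      case (Suc m)
      then obtain M where M: "M \<ge> 0" "\<And>z. norm z < r \<Longrightarrow> z \<noteq> 0 \<Longrightarrow> norm ((z / (f z - b)) ^ m - 1) \<le> M * norm z"
        by blast
      have "norm ((z / (f z - b)) ^ Suc m - 1) \<le> ((1 + K * r) * M + K) * norm z" if z: "norm z < r" "z \<noteq> 0" for z
      proof -
        let ?h = "z / (f z - b)"
        have h: "norm (?h - 1) \<le> K * norm z" using near_linear z by blast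
        have "norm ?h \<le> norm (?h - 1) + 1" using norm_triangle_ineq[of "?h - 1" 1] by simp
        also have "\<dots> \<le> 1 + K * r"
        proof -
          have "K * norm z \<le> K * r" using z K_pos by (intro mult_left_mono) auto
          then show ?thesis using h by linarith
        qed
        finally have h': "norm ?h \<le> 1 + K * r" .
        have "norm (?h ^ Suc m - 1) = norm (?h * (?h ^ m - 1) + (?h - 1))"
          by (simp add: algebra_simps)
        also have "\<dots> \<le> norm ?h * norm (?h ^ m - 1) + norm (?h - 1)"
          by (metis norm_mult norm_triangle_ineq)
        also have "\<dots> \<le> (1 + K * r) * (M * norm z) + K * norm z"
          using M(2)[OF z] h h' K_pos r_pos by (intro add_mono mult_mono) auto
        finally show ?thesis by (simp add: algebra_simps)
      qed
      moreover have "(1 + K * r) * M + K \<ge> 0" using K_pos r_pos M by simp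
      ultimately show ?case by blast
    qed (auto intro: exI[of _ 0])
    then show thesis using that by blast
  qed
  define B where "B = (1 / c) ^ m + M * (1 / \<delta>) ^ (m - 1)"
  have norm_an: "norm a ^ n \<ge> 1" for n using repelling by simp
  have far: "norm ((1 / (a ^ n * (orb \<sigma> n - b))) ^ m) \<le> (1 / c) ^ m / norm a ^ n" if "\<sigma> \<in> words_upto d n - near n" for \<sigma> n
  proof -
    have "norm ((1 / (a ^ n * (orb \<sigma> n - b))) ^ m) = (1 / norm (orb \<sigma> n - b)) ^ m * (1 / norm a ^ n) ^ m"
      by (simp add: norm_power norm_divide norm_mult power_divide power_mult_distrib)
    also have "\<dots> \<le> (1 / c) ^ m * (1 / norm a ^ n) ^ 1"
      using norm_an[of n] assms far_orb[OF that] c_pos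
      by (intro mult_mono power_mono power_decreasing divide_left_mono mult_pos_pos) auto
    finally show ?thesis by simp
  qed
  \<comment> \<open>Pulling out \<open>(1 / zeta \<sigma>) ^ m\<close> leaves an error proportional
    to \<open>norm (zeta \<sigma>) / norm a ^ n\<close>; this absorbs one inverse power of
    \<open>zeta \<sigma>\<close>, and \<open>\<delta>\<close> bounds the other
    \<open>m - 1\<close>.\<close>
  have near: "norm ((1 / (a ^ n * (orb \<sigma> n - b))) ^ m - (1 / zeta \<sigma>) ^ m) \<le> M * (1 / \<delta>) ^ (m - 1) / norm a ^ n" 
    if "\<sigma> \<in> near n" for \<sigma> n
  proof -
    have \<sigma>: "\<sigma> \<in> words" "norm (zeta \<sigma>) < r * norm a ^ n" using that by (auto simp: near_def)
    note z0 = zeta_nonzero[OF \<sigma>(1)]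
    define z where "z = zeta \<sigma> / a ^ n"
    have z: "norm z < r" "z \<noteq> 0"
      using \<sigma>(2) a_nonzero z0 by (auto simp: z_def norm_divide norm_power divide_less_eq)
    have "(1 / (a ^ n * (orb \<sigma> n - b))) ^ m - (1 / zeta \<sigma>) ^ m = (1 / zeta \<sigma>) ^ m * ((z / (f z - b)) ^ m - 1)"
    proof -
      have "1 / (a ^ n * (orb \<sigma> n - b)) = 1 / zeta \<sigma> * (z / (f z - b))"
        using z0 by (simp add: orb_eq[OF \<sigma>(1)] z_def)
      then show ?thesis by (simp only: power_mult_distrib right_diff_distrib mult_1_right)
    qed
    then have "norm ((1 / (a ^ n * (orb \<sigma> n - b))) ^ m - (1 / zeta \<sigma>) ^ m) = 
       (1 / norm (zeta \<sigma>)) ^ m * norm ((z / (f z - b)) ^ m - 1)"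
      by (simp add: norm_mult norm_power norm_divide)
    also have "\<dots> \<le> (1 / norm (zeta \<sigma>)) ^ m * (M * norm z)"
      using M(2)[OF z] by (intro mult_left_mono) auto
    also have "\<dots> = M * (1 / norm (zeta \<sigma>)) ^ (m - 1) / norm a ^ n"
    proof -
      obtain k where "m = Suc k" using assms by (cases m) auto
      then show ?thesis using z0 by (simp add: z_def norm_divide norm_power)
    qed
    also have "\<dots> \<le> M * (1 / \<delta>) ^ (m - 1) / norm a ^ n"
      using \<delta>(2)[OF \<sigma>(1)] \<delta>(1) M(1) norm_an[of n]
      by (intro divide_right_mono mult_left_mono power_mono divide_left_mono mult_pos_pos) auto
    finally show ?thesis .
  qed
  \<comment> \<open>There are \<open>d ^ n\<close> words, each with error at most
    \<open>B / norm a ^ n\<close>, whether near or far.\<close>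
  have bound: "norm (power_sum n m - (\<Sum>\<sigma>\<in>near n. (1 / zeta \<sigma>) ^ m)) \<le> B * (real d / norm a) ^ n" for n
  proof -
    let ?g = "\<lambda>\<sigma>. (1 / (a ^ n * (orb \<sigma> n - b))) ^ m - (if \<sigma> \<in> near n then (1 / zeta \<sigma>) ^ m else 0)"
    have fin: "finite (words_upto d n)" by (rule finite_words_upto[OF d_pos])
    have "(\<Sum>\<sigma>\<in>words_upto d n. if \<sigma> \<in> near n then (1 / zeta \<sigma>) ^ m else 0) = (\<Sum>\<sigma>\<in>near n. (1 / zeta \<sigma>) ^ m)"
      using near_subset_words_upto[of n] fin by (simp add: sum.inter_restrict[symmetric] Int_absorb1)
    then have "norm (power_sum n m - (\<Sum>\<sigma>\<in>near n. (1 / zeta \<sigma>) ^ m)) = norm (\<Sum>\<sigma>\<in>words_upto d n. ?g \<sigma>)"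
      by (simp add: power_sum_def sum_subtractf)
    also have "\<dots> \<le> real (card (words_upto d n)) * (B / norm a ^ n)"
    proof (rule sum_norm_bound)
      fix \<sigma> assume \<sigma>: "\<sigma> \<in> words_upto d n"
      have le: "(1 / c) ^ m / norm a ^ n \<le> B / norm a ^ n" "M * (1 / \<delta>) ^ (m - 1) / norm a ^ n \<le> B / norm a ^ n"
        using M(1) \<delta>(1) c_pos by (auto simp: B_def intro!: divide_right_mono)
      show "norm (?g \<sigma>) \<le> B / norm a ^ n"
      proof (cases "\<sigma> \<in> near n")
        case True
        then show ?thesis using near[of \<sigma> n] le(2) by simp
      next
        case False
        then show ?thesis using far[of \<sigma> n] \<sigma> le(1) by simp
      qed
    qed
    finally show ?thesis by (simp add: card_words_upto[OF d_pos] power_divide mult.commute)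
  qed
  have "(\<lambda>n. B * (real d / norm a) ^ n) \<longlonglongrightarrow> B * 0"
    by (intro tendsto_intros LIMSEQ_power_zero) (use growth repelling in \<open>simp add: divide_less_eq\<close>)
  then have lim: "(\<lambda>n. power_sum n m - (\<Sum>\<sigma>\<in>near n. (1 / zeta \<sigma>) ^ m)) \<longlonglongrightarrow> 0"
    by (intro Lim_null_comparison[OF always_eventually[OF allI[OF bound]]]) simp
  show ?thesis
    using tendsto_diff[OF power_sum_tendsto[OF assms] lim] by simp
qed

section \<open>Unconditional summation over all words\<close>

lemma incseq_near: "n \<le> n' \<Longrightarrow> near n \<subseteq> near n'"
proof
  fix \<sigma> assume "n \<le> n'" "\<sigma> \<in> near n"
  moreover have "r * norm a ^ n \<le> r * norm a ^ n'"
    using \<open>n \<le> n'\<close> repelling r_pos by (intro mult_left_mono power_increasing) auto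
  ultimately show "\<sigma> \<in> near n'" by (auto simp: near_def)
qed

text \<open>The sets \<open>near n\<close> increase and exhaust the words since
  \<open>norm a ^ n\<close> is unbounded, so an unconditional sum can be evaluated along
  them.\<close>

lemma filterlim_near: "filterlim near (finite_subsets_at_top words) sequentially"
  unfolding filterlim_finite_subsets_at_top
proof (intro allI impI)
  fix X assume X: "finite X \<and> X \<subseteq> words"
  have "eventually (\<lambda>n. \<sigma> \<in> near n) sequentially" if "\<sigma> \<in> X" for \<sigma>
  proof -
    obtain N where "norm (zeta \<sigma>) / r < norm a ^ N" using real_arch_pow[OF repelling] by blast
    then have "\<sigma> \<in> near N" using that X r_pos by (auto simp: near_def divide_less_eq mult.commute)
    then show ?thesis using incseq_near unfolding eventually_sequentially by blast
  qed
  then have "eventually (\<lambda>n. \<forall>\<sigma>\<in>X. \<sigma> \<in> near n) sequentially"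
    using X by (simp add: eventually_ball_finite)
  then show "eventually (\<lambda>n. finite (near n) \<and> X \<subseteq> near n \<and> near n \<subseteq> words) sequentially"
    by eventually_elim (auto simp: finite_near, simp add: near_def)
qed

text \<open>Passing from \<open>near n\<close> to \<open>near (Suc n)\<close> adds at most
  \<open>d ^ Suc n\<close> words, each with
  \<open>norm (zeta \<sigma>) \<ge> r * norm a ^ n\<close>; \<open>near 0\<close> has at most one
  word, bounded through \<open>\<delta>\<close>.\<close>

lemma near_abs_sum_bounded:
  assumes "\<delta> > 0" "\<And>\<sigma>. \<sigma> \<in> words \<Longrightarrow> norm (zeta \<sigma>) \<ge> \<delta>"
  shows "(\<Sum>\<sigma>\<in>near n. 1 / norm (zeta \<sigma>)) \<le> 1 / \<delta> + real d / r * (\<Sum>k<n. (real d / norm a) ^ k)"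
proof (induction n)
  case 0
  have "(\<Sum>\<sigma>\<in>near 0. 1 / norm (zeta \<sigma>)) \<le> real (card (near 0)) * (1 / \<delta>)"
    by (intro sum_bounded_above divide_left_mono assms mult_pos_pos) 
      (use assms zeta_nonzero in \<open>auto simp: near_def\<close>)
  also have "\<dots> \<le> 1 * (1 / \<delta>)"
    using card_near_le[of 0] assms(1) by (intro mult_right_mono) auto
  finally show ?case by simp
next
  case (Suc n)
  have pos: "r * norm a ^ n > 0" using r_pos a_nonzero by simp
  have "(\<Sum>\<sigma>\<in>near (Suc n) - near n. 1 / norm (zeta \<sigma>)) \<le> real (card (near (Suc n) - near n)) * (1 / (r * norm a ^ n))"
  proof (rule sum_bounded_above)
    fix \<sigma> assume \<sigma>: "\<sigma> \<in> near (Suc n) - near n"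
    then have "norm (zeta \<sigma>) \<ge> r * norm a ^ n" by (auto simp: near_def)
    then show "1 / norm (zeta \<sigma>) \<le> 1 / (r * norm a ^ n)"
      using pos by (intro frac_le) auto
  qed
  also have "\<dots> \<le> real (d ^ Suc n) * (1 / (r * norm a ^ n))"
  proof -
    have "card (near (Suc n) - near n) \<le> d ^ Suc n"
      using card_mono[OF finite_near, of "near (Suc n) - near n" "Suc n"] card_near_le[of "Suc n"] by auto
    then show ?thesis using pos by (intro mult_right_mono of_nat_mono) auto
  qed
  also have "\<dots> = real d / r * (real d / norm a) ^ n"
    by (simp add: power_divide)
  finally have "(\<Sum>\<sigma>\<in>near (Suc n) - near n. 1 / norm (zeta \<sigma>)) \<le> real d / r * (real d / norm a) ^ n" .
  moreover have "(\<Sum>\<sigma>\<in>near (Suc n). 1 / norm (zeta \<sigma>)) = 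
     (\<Sum>\<sigma>\<in>near (Suc n) - near n. 1 / norm (zeta \<sigma>)) + (\<Sum>\<sigma>\<in>near n. 1 / norm (zeta \<sigma>))"
    using finite_near incseq_near by (intro sum.subset_diff) auto
  ultimately show ?case using Suc.IH by (simp add: distrib_left)
qed

text \<open>The lower bound \<open>\<delta>\<close> reduces the exponent to 1; there
  \<open>near_abs_sum_bounded\<close> gives a geometric series of ratio
  \<open>d / norm a < 1\<close>. Every finite set of words lies in some
  \<open>near n\<close>.\<close>

lemma summable_inverse_zeta:
  assumes "m \<ge> 1"
  shows "(\<lambda>\<sigma>. (1 / zeta \<sigma>) ^ m) summable_on words"
proof -
  obtain \<delta> where \<delta>: "\<delta> > 0" "\<And>\<sigma>. \<sigma> \<in> words \<Longrightarrow> norm (zeta \<sigma>) \<ge> \<delta>"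
    using zeta_bounded_below by blast
  define q where "q = real d / norm a"
  have q: "q \<ge> 0" "q < 1" using growth repelling by (auto simp: q_def divide_less_eq)
  define B where "B = (1 / \<delta>) ^ (m - 1) * (1 / \<delta> + real d / r * (1 / (1 - q)))"
  have "(\<lambda>\<sigma>. norm ((1 / zeta \<sigma>) ^ m)) summable_on words"
  proof (rule nonneg_bdd_above_summable_on)
    show "bdd_above (sum (\<lambda>\<sigma>. norm ((1 / zeta \<sigma>) ^ m)) ` {X. X \<subseteq> words \<and> finite X})"
    proof (rule bdd_aboveI2[where M = B])
      fix X assume "X \<in> {X. X \<subseteq> words \<and> finite X}"
      then have X: "X \<subseteq> words" "finite X" by auto
      have "eventually (\<lambda>n. finite (near n) \<and> X \<subseteq> near n \<and> near n \<subseteq> words) sequentially"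
        using filterlim_near X unfolding filterlim_finite_subsets_at_top by blast
      then obtain n where n: "X \<subseteq> near n" "near n \<subseteq> words" 
        by (auto simp: eventually_sequentially)
      have "(\<Sum>\<sigma>\<in>X. norm ((1 / zeta \<sigma>) ^ m)) \<le> (\<Sum>\<sigma>\<in>near n. norm ((1 / zeta \<sigma>) ^ m))"
        using n finite_near by (intro sum_mono2) auto
      also have "\<dots> \<le> (\<Sum>\<sigma>\<in>near n. (1 / \<delta>) ^ (m - 1) * (1 / norm (zeta \<sigma>)))"
      proof (rule sum_mono)
        fix \<sigma> assume "\<sigma> \<in> near n"
        then have "\<sigma> \<in> words" using n by blast
        obtain k where k: "m = Suc k" using assms by (cases m) auto
        have "norm ((1 / zeta \<sigma>) ^ m) = (1 / norm (zeta \<sigma>)) ^ (m - 1) * (1 / norm (zeta \<sigma>))"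
          by (simp add: k norm_divide norm_power norm_mult power_divide)
        also have "\<dots> \<le> (1 / \<delta>) ^ (m - 1) * (1 / norm (zeta \<sigma>))"
          using \<delta>(1) \<delta>(2)[OF \<open>\<sigma> \<in> words\<close>] by (intro mult_right_mono power_mono divide_left_mono mult_pos_pos) auto
        finally show "norm ((1 / zeta \<sigma>) ^ m) \<le> (1 / \<delta>) ^ (m - 1) * (1 / norm (zeta \<sigma>))" .
      qed
      also have "\<dots> \<le> (1 / \<delta>) ^ (m - 1) * (1 / \<delta> + real d / r * (\<Sum>k<n. q ^ k))"
        unfolding sum_distrib_left[symmetric] q_def
        using near_abs_sum_bounded[OF \<delta>] \<delta>(1) by (intro mult_left_mono) auto
      also have "\<dots> \<le> B"
      proof -
        have "(\<Sum>k<n. q ^ k) \<le> 1 / (1 - q)"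
          using q sum_gp_strict[of q n] by (auto simp: divide_right_mono)
        then show ?thesis unfolding B_def using \<delta>(1) r_pos
          by (intro mult_left_mono add_left_mono) auto
      qed
      finally show "(\<Sum>\<sigma>\<in>X. norm ((1 / zeta \<sigma>) ^ m)) \<le> B" .
    qed
  qed simp
  then show ?thesis by (rule abs_summable_summable)
qed

text \<open>Summability makes the sum equal to its limit along \<open>near n\<close>, which
  \<open>near_sum_tendsto\<close> computes.\<close>

lemma has_sum_inverse_zeta:
  assumes "m \<ge> 1"
  shows "((\<lambda>\<sigma>. (1 / zeta \<sigma>) ^ m) has_sum moment m) words"
proof -
  obtain s where s: "((\<lambda>\<sigma>. (1 / zeta \<sigma>) ^ m) has_sum s) words"
    using summable_inverse_zeta[OF assms] by (auto simp: summable_on_def)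
  then have "(\<lambda>n. \<Sum>\<sigma>\<in>near n. (1 / zeta \<sigma>) ^ m) \<longlonglongrightarrow> s"
    unfolding has_sum_def by (rule filterlim_compose[OF _ filterlim_near])
  then have "s = moment m" using near_sum_tendsto[OF assms] LIMSEQ_unique by blast
  then show ?thesis using s by simp
qed

text \<open>Termwise, the factor \<open>m / j\<close> turns \<open>fact j / fact m\<close> into
  \<open>fact (j - 1) / fact (m - 1)\<close>.\<close>

lemma moment_eq:
  assumes "m \<ge> 1"
  shows "(w - b) ^ m * moment m = 
    (\<Sum>j=1..m. (w - b) ^ (m - j) * fact (j - 1) / fact (m - 1) * bell_poly m j (\<lambda>i. (deriv ^^ i) f 0))"
  unfolding moment_def sum_distrib_left
proof (rule sum.cong)
  fix j assume j: "j \<in> {1..m}"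
  have "(w - b) ^ m * (1 / (w - b)) ^ j = (w - b) ^ (m - j)"
    using j w_neq by (simp add: power_diff power_divide)
  moreover have "(w - b) ^ m * (of_nat m * ((1 / (w - b)) ^ j / of_nat j * (f_series ^ j) $ m)) =
    (w - b) ^ m * (1 / (w - b)) ^ j * fact (j - 1) / fact (m - 1) * bell_poly m j (\<lambda>i. (deriv ^^ i) f 0)"
  proof -
    have "X * (M * (Y / J * (J * fj / (M * fm) * B))) = X * Y * fj / fm * B"
      if "J \<noteq> 0" "M \<noteq> 0" for X M Y J fj fm B :: complex
      using that by simp
    from this[of "of_nat j" "of_nat m"] show ?thesis
      using j assms by (simp add: f_series_power_nth fact_reduce del: of_nat_Suc)
  qed
  ultimately show "(w - b) ^ m * (of_nat m * ((1 / (w - b)) ^ j / of_nat j * (f_series ^ j) $ m)) =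
    (w - b) ^ (m - j) * fact (j - 1) / fact (m - 1) * bell_poly m j (\<lambda>i. (deriv ^^ i) f 0)"
    by simp
qed simp

lemma has_sum_orbit_products:
  assumes "m \<ge> 1"
  shows "((\<lambda>\<sigma>. \<Prod>n. poly (quot_poly P b) (orb \<sigma> (Suc n)) ^ m / a ^ m) has_sum
    (\<Sum>j=1..m. (w - b) ^ (m - j) * fact (j - 1) / fact (m - 1) * bell_poly m j (\<lambda>i. (deriv ^^ i) f 0))) words"
proof -
  have "((\<lambda>\<sigma>. (w - b) ^ m * (1 / zeta \<sigma>) ^ m) has_sum (w - b) ^ m * moment m) words"
    by (intro has_sum_cmult_right has_sum_inverse_zeta assms)
  then show ?thesis unfolding moment_eq[OF assms]
    by (rule has_sum_cong[THEN iffD1, rotated]) (simp add: orbit_product(2) del: backward_orbit.simps)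
qed

end

section \<open>Moment formulas\<close>

context poincare_function
begin

lemma orbit_products:
  assumes "w \<noteq> b" "m \<ge> 1"
  shows convergent_orbit_product: "\<sigma> \<in> eventually_zero_words d \<Longrightarrow>
      convergent_prod (\<lambda>n. poly (quot_poly P b) (backward_orbit R \<sigma> w (Suc n)) ^ m / a ^ m)"
    and moment_formula:
      "((\<lambda>\<sigma>. \<Prod>n. poly (quot_poly P b) (backward_orbit R \<sigma> w (Suc n)) ^ m / a ^ m) has_sum
        (\<Sum>j=1..m. (w - b) ^ (m - j) * fact (j - 1) / fact (m - 1) *
           bell_poly m j (\<lambda>i. (deriv ^^ i) f 0))) (eventually_zero_words d)"
proof -
  obtain r c K where "r > 0" "c > 0" "K > 0"
    "\<forall>z. norm z < r \<longrightarrow> R 0 (f z) = f (z / a)"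
    "\<forall>z i. norm z < r \<longrightarrow> i < d \<longrightarrow> R i (f z) = f (z / a) \<longrightarrow> i = 0"
    "\<forall>u. norm (u - b) < c \<longrightarrow> (\<exists>z. norm z < r \<and> f z = u)"
    "\<forall>z. norm z < r \<longrightarrow> z \<noteq> 0 \<longrightarrow> norm (z / (f z - b) - 1) \<le> K * norm z"
    by (rule local_linearization)
  then interpret poincare_point P d a b f R w r c K
    by unfold_locales (use assms in auto)
  show "\<sigma> \<in> eventually_zero_words d \<Longrightarrow>
      convergent_prod (\<lambda>n. poly (quot_poly P b) (backward_orbit R \<sigma> w (Suc n)) ^ m / a ^ m)"
    by (rule orbit_product(1))
  show "((\<lambda>\<sigma>. \<Prod>n. poly (quot_poly P b) (backward_orbit R \<sigma> w (Suc n)) ^ m / a ^ m) has_sum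
        (\<Sum>j=1..m. (w - b) ^ (m - j) * fact (j - 1) / fact (m - 1) *
           bell_poly m j (\<lambda>i. (deriv ^^ i) f 0))) (eventually_zero_words d)"
    using assms(2) by (rule has_sum_orbit_products)
qed

lemma deriv2_eq: "(deriv ^^ 2) f 0 = inverse (a ^ 2 - a) * poly ((pderiv ^^ 2) P) b"
  using higher_deriv_recurrence[of 2] by (simp add: bell_poly_2_2)

lemma moment_formula_1:
  assumes "w \<noteq> b"
  shows "((\<lambda>\<sigma>. \<Prod>n. poly (quot_poly P b) (backward_orbit R \<sigma> w (Suc n)) / a) has_sum deriv f 0)
    (eventually_zero_words d)"
  using moment_formula[OF assms, of 1] bell_poly_1[of 1] by (simp del: backward_orbit.simps)

lemma moment_formula_2:
  assumes "w \<noteq> b"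
  shows "((\<lambda>\<sigma>. \<Prod>n. poly (quot_poly P b) (backward_orbit R \<sigma> w (Suc n)) ^ 2 / a ^ 2) has_sum
    (deriv f 0 ^ 2 + (w - b) * (deriv ^^ 2) f 0)) (eventually_zero_words d)"
proof -
  have "{1..2} = {1, 2 :: nat}" by auto
  \<comment> \<open>Since \<open>deriv f 0 = 1\<close>, the value 1 of \<open>bell_poly 2 2\<close>
    can be written as \<open>deriv f 0 ^ 2\<close>.\<close>
  then have "(\<Sum>j=1..2. (w - b) ^ (2 - j) * fact (j - 1) / fact (2 - 1) * bell_poly 2 j (\<lambda>i. (deriv ^^ i) f 0))
     = deriv f 0 ^ 2 + (w - b) * (deriv ^^ 2) f 0"
    using bell_poly_1[of 2] by (simp add: bell_poly_2_2 deriv_f_0)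
  then show ?thesis using moment_formula[OF assms, of 2] by (simp only: one_le_numeral)
qed

end

text \<open>The right-hand sides for \<open>m \<ge> 2\<close> carry powers of \<open>w - b\<close>;
  the forms with \<open>- b\<close> are the case \<open>w = 0\<close>, admissible because
  \<open>b \<noteq> 0\<close>. For \<open>m = 1\<close> the only term has exponent 0, so the sum is
  the same for all \<open>w\<close>.\<close>

theorem mainTheorem6:
  fixes P :: "complex poly" and d :: nat and a b :: complex
    and f :: "complex \<Rightarrow> complex"
    and P_inv :: "nat \<Rightarrow> complex \<Rightarrow> complex"
  assumes "degree P = d" and "d \<ge> 2"
    and "b \<noteq> 0" and "poly P b = b"
    and "a = poly (pderiv P) b" and "norm a > 1"
    and "f holomorphic_on UNIV"
    and "\<And>z. f (a * z) = poly P (f z)"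
    and "f 0 = b" and "deriv f 0 = 1"
    and "\<And>w. image_mset (\<lambda>i. P_inv i w) (mset_set {..<d}) = proots (P - [:w:])"
    and "P_inv 0 b = b"
    and "\<exists>U. open U \<and> b \<in> U \<and> P_inv 0 analytic_on U"
    and "\<And>w. (\<lambda>n. (P_inv 0 ^^ n) w) \<longlonglongrightarrow> b"
    and "real d < norm a"
  shows
    "(\<forall>w. w \<noteq> b \<longrightarrow> (\<forall>m\<ge>1. \<forall>\<sigma>\<in>eventually_zero_words d.
       convergent_prod (\<lambda>n. poly (quot_poly P b) (backward_orbit P_inv \<sigma> w (Suc n)) ^ m / a ^ m))) \<and>
     (\<forall>w. w \<noteq> b \<longrightarrow>
       ((\<lambda>\<sigma>. \<Prod>n. poly (quot_poly P b) (backward_orbit P_inv \<sigma> w (Suc n)) / a)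
          has_sum deriv f 0) (eventually_zero_words d)) \<and>
     (deriv f 0 = 1) \<and>
     (\<forall>w. w \<noteq> b \<longrightarrow>
       ((\<lambda>\<sigma>. \<Prod>n. poly (quot_poly P b) (backward_orbit P_inv \<sigma> w (Suc n)) ^ 2 / a ^ 2)
          has_sum (deriv f 0 ^ 2 + (w - b) * (deriv ^^ 2) f 0)) (eventually_zero_words d) \<and>
       deriv f 0 ^ 2 + (w - b) * (deriv ^^ 2) f 0
         = 1 + (w - b) * poly ((pderiv ^^ 2) P) b / (a ^ 2 - a)) \<and>
     (\<forall>w. w \<noteq> b \<longrightarrow> (\<forall>m\<ge>2.
       ((\<lambda>\<sigma>. \<Prod>n. poly (quot_poly P b) (backward_orbit P_inv \<sigma> w (Suc n)) ^ m / a ^ m)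
          has_sum (\<Sum>j=1..m. (w - b) ^ (m - j) * fact (j - 1) / fact (m - 1) *
                     bell_poly m j (\<lambda>i. (deriv ^^ i) f 0))) (eventually_zero_words d))) \<and>
     (((\<lambda>\<sigma>. \<Prod>n. poly (quot_poly P b) (backward_orbit P_inv \<sigma> 0 (Suc n)) ^ 2 / a ^ 2)
          has_sum (deriv f 0 ^ 2 - b * (deriv ^^ 2) f 0)) (eventually_zero_words d)) \<and>
     (deriv f 0 ^ 2 - b * (deriv ^^ 2) f 0 = 1 - b * poly ((pderiv ^^ 2) P) b / (a ^ 2 - a)) \<and>
     (\<forall>m\<ge>2.
       ((\<lambda>\<sigma>. \<Prod>n. poly (quot_poly P b) (backward_orbit P_inv \<sigma> 0 (Suc n)) ^ m / a ^ m)
          has_sum (\<Sum>j=1..m. (- b) ^ (m - j) * fact (j - 1) / fact (m - 1) *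
                     bell_poly m j (\<lambda>i. (deriv ^^ i) f 0))) (eventually_zero_words d)) \<and>
     ((deriv ^^ 2) f 0 = inverse (a ^ 2 - a) * poly ((pderiv ^^ 2) P) b) \<and>
     (\<forall>m\<ge>2. (deriv ^^ m) f 0 = inverse (a ^ m - a) *
       (\<Sum>j=2..m. poly ((pderiv ^^ j) P) b * bell_poly m j (\<lambda>i. (deriv ^^ i) f 0)))"
proof -
  \<comment> \<open>Analyticity near \<open>b\<close> enters as continuity at
    \<open>b\<close>.\<close>
  have "isCont (P_inv 0) b"
    using assms(13) by (metis analytic_on_imp_differentiable_at field_differentiable_imp_continuous_at)
  then interpret poincare_function P d a b f P_inv
    by unfold_locales (rule assms | assumption)+
  have 2: "deriv f 0 ^ 2 + x * (deriv ^^ 2) f 0 = 1 + x * poly ((pderiv ^^ 2) P) b / (a ^ 2 - a)" for x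
    unfolding deriv2_eq using assms(10) by (simp add: divide_inverse)
  have 3: "deriv f 0 ^ 2 - b * (deriv ^^ 2) f 0 = 1 - b * poly ((pderiv ^^ 2) P) b / (a ^ 2 - a)"
    using 2[of "- b"] by simp
  have b0: "0 \<noteq> b" using assms(3) by simp
  show ?thesis
  proof (intro conjI allI impI ballI)
    fix w m \<sigma> assume "w \<noteq> b" "1 \<le> (m :: nat)" "\<sigma> \<in> eventually_zero_words d"
    then show "convergent_prod (\<lambda>n. poly (quot_poly P b) (backward_orbit P_inv \<sigma> w (Suc n)) ^ m / a ^ m)"
      by (rule convergent_orbit_product)
  next
    fix w assume "w \<noteq> b"
    then show "((\<lambda>\<sigma>. \<Prod>n. poly (quot_poly P b) (backward_orbit P_inv \<sigma> w (Suc n)) / a) has_sum deriv f 0)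
      (eventually_zero_words d)"
      by (rule moment_formula_1)
  next
    fix w assume "w \<noteq> b"
    then show "((\<lambda>\<sigma>. \<Prod>n. poly (quot_poly P b) (backward_orbit P_inv \<sigma> w (Suc n)) ^ 2 / a ^ 2) has_sum
      (deriv f 0 ^ 2 + (w - b) * (deriv ^^ 2) f 0)) (eventually_zero_words d)"
      by (rule moment_formula_2)
  next
    fix w and m :: nat assume w: "w \<noteq> b" and m: "2 \<le> m"
    have "1 \<le> m" using m by simp
    with w show "((\<lambda>\<sigma>. \<Prod>n. poly (quot_poly P b) (backward_orbit P_inv \<sigma> w (Suc n)) ^ m / a ^ m) has_sum
      (\<Sum>j=1..m. (w - b) ^ (m - j) * fact (j - 1) / fact (m - 1) * bell_poly m j (\<lambda>i. (deriv ^^ i) f 0)))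
      (eventually_zero_words d)"
      by (rule moment_formula)
  next
    show "((\<lambda>\<sigma>. \<Prod>n. poly (quot_poly P b) (backward_orbit P_inv \<sigma> 0 (Suc n)) ^ 2 / a ^ 2) has_sum
      (deriv f 0 ^ 2 - b * (deriv ^^ 2) f 0)) (eventually_zero_words d)"
      using moment_formula_2[OF b0] by (simp del: backward_orbit.simps)
  next
    fix m :: nat assume m: "2 \<le> m"
    have "1 \<le> m" using m by simp
    from moment_formula[OF b0 this]
    show "((\<lambda>\<sigma>. \<Prod>n. poly (quot_poly P b) (backward_orbit P_inv \<sigma> 0 (Suc n)) ^ m / a ^ m) has_sum
      (\<Sum>j=1..m. (- b) ^ (m - j) * fact (j - 1) / fact (m - 1) * bell_poly m j (\<lambda>i. (deriv ^^ i) f 0)))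
      (eventually_zero_words d)"
      by (simp only: diff_0)
  next
    fix m :: nat assume "2 \<le> m"
    then show "(deriv ^^ m) f 0 = inverse (a ^ m - a) *
       (\<Sum>j=2..m. poly ((pderiv ^^ j) P) b * bell_poly m j (\<lambda>i. (deriv ^^ i) f 0))"
      by (rule higher_deriv_recurrence)
  qed (rule assms(10) 2 3 deriv2_eq)+
qed

end
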